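(* Let $n$ be a positive odd integer with $n\equiv2\pmod3$ satisfying one of: (a) $n\ge19$, $n\equiv0\pmod5$; (b) $n\ge207$, $n\equiv1\pmod5$; (c) $n\ge114$, $n\equiv2\pmod5$; (d) $n\ge154$, $n\equiv3\pmod5$; (e) $n\ge232$, $n\equiv4\pmod5$. Let $H$ be any abelian group of order $n^2+n+1$. Then there are no inverse-closed subsets $T_0,T_1\subseteq H$ with $e\in T_0$ satisfying $T_0T_1=H-e$ and $T_0^2+T_1^2=2H-T_0^{(2)}-T_1^{(2)}+2ne$ in $\mathbb{Z}[H]$.
   Context: $H$ is written multiplicatively with identity $e$; $\mathbb{Z}[H]$ is the integral group ring, a subset $D\subseteq H$ is identified with $\sum_{g\in D}g$, and $H$ also denotes $\sum_{h\in H}h$. For $A=\sum a_gg$ and $t\in\mathbb{Z}$, $A^{(t)}=\sum a_gg^t$. Inverse-closed means $T^{(-1)}=T$. *)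

theory Defs
  imports
    "HOL-Algebra.Ring"
    "HOL-Algebra.Coset"
    "HOL-Library.Indicator_Function"
    "HOL-Number_Theory.Cong"
begin

text \<open>
  An element of the integral group ring of \<open>G\<close> is its coefficient function: it has finite
  support and vanishes outside \<open>carrier G\<close>, so that equality in the ring is equality of functions.
  A subset \<open>D\<close> of \<open>carrier G\<close>, read as the sum of its elements, is \<open>indicator D\<close>;
  the group identity, as an element of the ring, is the unit of the ring.
\<close>

definition group_ring :: "('a, 'b) monoid_scheme \<Rightarrow> ('a \<Rightarrow> int) ring" where
  "group_ring G =
    \<lparr> carrier = {A. finite {g. A g \<noteq> 0} \<and> {g. A g \<noteq> 0} \<subseteq> carrier G},
      monoid.mult = (\<lambda>A B g. \<Sum>(x, y) | A x \<noteq> 0 \<and> B y \<noteq> 0 \<and> x \<otimes>\<^bsub>G\<^esub> y = g. A x * B y),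
      monoid.one = indicator {\<one>\<^bsub>G\<^esub>},
      ring.zero = (\<lambda>_. 0),
      ring.add = (\<lambda>A B g. A g + B g) \<rparr>"

text \<open>\<open>A\<^sup>(\<^sup>t\<^sup>)\<close>: each group element \<open>g\<close> is replaced by \<open>g\<^sup>t\<close>, the coefficients of elements
  with the same \<open>t\<close>-th power being added up. This is not the ring power.\<close>

definition power_map :: "('a, 'b) monoid_scheme \<Rightarrow> int \<Rightarrow> ('a \<Rightarrow> int) \<Rightarrow> ('a \<Rightarrow> int)" where
  "power_map G t A = (\<lambda>h. \<Sum>g | A g \<noteq> 0 \<and> g [^]\<^bsub>G\<^esub> t = h. A g)"

definition inverse_closed :: "('a, 'b) monoid_scheme \<Rightarrow> 'a set \<Rightarrow> bool" where
  "inverse_closed G T \<longleftrightarrow> power_map G (-1) (indicator T) = indicator T"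

lemma group_ring_mult:
  assumes X: "finite X" "{x. A x \<noteq> 0} \<subseteq> X" and Y: "finite Y" "{y. B y \<noteq> 0} \<subseteq> Y"
  shows "(A \<otimes>\<^bsub>group_ring G\<^esub> B) g = (\<Sum>x\<in>X. \<Sum>y\<in>Y. if x \<otimes>\<^bsub>G\<^esub> y = g then A x * B y else 0)"
proof -
  have "(\<Sum>x\<in>X. \<Sum>y\<in>Y. if x \<otimes>\<^bsub>G\<^esub> y = g then A x * B y else 0) =
        (\<Sum>(x, y)\<in>X \<times> Y. if x \<otimes>\<^bsub>G\<^esub> y = g then A x * B y else 0)"
    by (rule sum.cartesian_product)
  also have "\<dots> = (\<Sum>(x, y) | A x \<noteq> 0 \<and> B y \<noteq> 0 \<and> x \<otimes>\<^bsub>G\<^esub> y = g. A x * B y)"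
    using X Y by (intro sum.mono_neutral_cong_right) (auto split: if_splits)
  finally show ?thesis by (simp add: group_ring_def)
qed

lemma group_ring_cring:
  fixes G (structure)
  assumes "comm_group G"
  shows "cring (group_ring G)"
proof -
  interpret comm_group G by fact
  let ?R = "group_ring G"
  have car: "A \<in> carrier ?R \<longleftrightarrow> finite {g. A g \<noteq> 0} \<and> {g. A g \<noteq> 0} \<subseteq> carrier G" for A
    by (simp add: group_ring_def)
  have plus: "A \<oplus>\<^bsub>?R\<^esub> B = (\<lambda>g. A g + B g)" for A B
    by (simp add: group_ring_def)
  have zero: "\<zero>\<^bsub>?R\<^esub> = (\<lambda>_. 0)" and one: "\<one>\<^bsub>?R\<^esub> = indicator {\<one>}"
    by (simp_all add: group_ring_def)
  have mult: "(A \<otimes>\<^bsub>?R\<^esub> B) g =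
      (\<Sum>x | A x \<noteq> 0. \<Sum>y | B y \<noteq> 0. if x \<otimes> y = g then A x * B y else 0)"
    if "A \<in> carrier ?R" "B \<in> carrier ?R" for A B g
    using that by (intro group_ring_mult) (auto simp: car)
  have supp: "{g. (A \<otimes>\<^bsub>?R\<^esub> B) g \<noteq> 0} \<subseteq> (\<lambda>(x, y). x \<otimes> y) ` ({x. A x \<noteq> 0} \<times> {y. B y \<noteq> 0})"
    if "A \<in> carrier ?R" "B \<in> carrier ?R" for A B
  proof
    fix g assume "g \<in> {g. (A \<otimes>\<^bsub>?R\<^esub> B) g \<noteq> 0}"
    then have "(\<Sum>x | A x \<noteq> 0. \<Sum>y | B y \<noteq> 0. if x \<otimes> y = g then A x * B y else 0) \<noteq> 0"
      using mult[OF that] by simp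
    then obtain x where x: "x \<in> {x. A x \<noteq> 0}"
      "(\<Sum>y | B y \<noteq> 0. if x \<otimes> y = g then A x * B y else 0) \<noteq> 0"
      by (rule sum.not_neutral_contains_not_neutral)
    from x(2) obtain y where y: "y \<in> {y. B y \<noteq> 0}" "(if x \<otimes> y = g then A x * B y else 0) \<noteq> 0"
      by (rule sum.not_neutral_contains_not_neutral)
    from y(2) have "x \<otimes> y = g" by (simp split: if_splits)
    with x(1) y(1) show "g \<in> (\<lambda>(x, y). x \<otimes> y) ` ({x. A x \<noteq> 0} \<times> {y. B y \<noteq> 0})"
      by auto
  qed
  have closed: "A \<otimes>\<^bsub>?R\<^esub> B \<in> carrier ?R" if "A \<in> carrier ?R" "B \<in> carrier ?R" for A B
  proof -
    have "finite ((\<lambda>(x, y). x \<otimes> y) ` ({x. A x \<noteq> 0} \<times> {y. B y \<noteq> 0}))"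
      using that by (auto simp: car)
    moreover have "(\<lambda>(x, y). x \<otimes> y) ` ({x. A x \<noteq> 0} \<times> {y. B y \<noteq> 0}) \<subseteq> carrier G"
      using that by (auto simp: car)
    ultimately show ?thesis
      using supp[OF that] by (simp only: car) (meson finite_subset subset_trans)
  qed
  have comm: "A \<otimes>\<^bsub>?R\<^esub> B = B \<otimes>\<^bsub>?R\<^esub> A" if AB: "A \<in> carrier ?R" "B \<in> carrier ?R" for A B
  proof
    fix g
    have "(A \<otimes>\<^bsub>?R\<^esub> B) g = (\<Sum>y | B y \<noteq> 0. \<Sum>x | A x \<noteq> 0. if x \<otimes> y = g then A x * B y else 0)"
      unfolding mult[OF AB] by (rule sum.swap)
    also have "\<dots> = (B \<otimes>\<^bsub>?R\<^esub> A) g"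
      unfolding mult[OF AB(2,1)] using AB
      by (intro sum.cong refl) (auto simp: car subset_iff m_comm mult.commute)
    finally show "(A \<otimes>\<^bsub>?R\<^esub> B) g = (B \<otimes>\<^bsub>?R\<^esub> A) g" .
  qed
  have triple: "((A \<otimes>\<^bsub>?R\<^esub> B) \<otimes>\<^bsub>?R\<^esub> C) g = (\<Sum>z | C z \<noteq> 0. \<Sum>x | A x \<noteq> 0. \<Sum>y | B y \<noteq> 0.
      if (x \<otimes> y) \<otimes> z = g then A x * B y * C z else 0)"
    if ABC: "A \<in> carrier ?R" "B \<in> carrier ?R" "C \<in> carrier ?R" for A B C g
  proof -
    let ?W = "(\<lambda>(x, y). x \<otimes> y) ` ({x. A x \<noteq> 0} \<times> {y. B y \<noteq> 0})"
    have finW: "finite ?W" using ABC by (auto simp: car)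
    have "((A \<otimes>\<^bsub>?R\<^esub> B) \<otimes>\<^bsub>?R\<^esub> C) g =
        (\<Sum>w\<in>?W. \<Sum>z | C z \<noteq> 0. if w \<otimes> z = g then (A \<otimes>\<^bsub>?R\<^esub> B) w * C z else 0)"
      using supp[OF ABC(1,2)] finW ABC(3) by (intro group_ring_mult) (auto simp: car)
    also have "\<dots> = (\<Sum>z | C z \<noteq> 0. \<Sum>w\<in>?W. if w \<otimes> z = g then (A \<otimes>\<^bsub>?R\<^esub> B) w * C z else 0)"
      by (rule sum.swap)
    also have "\<dots> = (\<Sum>z | C z \<noteq> 0. \<Sum>w\<in>?W. \<Sum>x | A x \<noteq> 0. \<Sum>y | B y \<noteq> 0.
        if w = x \<otimes> y then if w \<otimes> z = g then A x * B y * C z else 0 else 0)"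
    proof (intro sum.cong refl)
      fix z w
      show "(if w \<otimes> z = g then (A \<otimes>\<^bsub>?R\<^esub> B) w * C z else 0) =
          (\<Sum>x | A x \<noteq> 0. \<Sum>y | B y \<noteq> 0.
            if w = x \<otimes> y then if w \<otimes> z = g then A x * B y * C z else 0 else 0)"
      proof (cases "w \<otimes> z = g")
        case True
        then show ?thesis
          by (auto simp: mult[OF ABC(1,2)] sum_distrib_right intro!: sum.cong)
      next
        case False
        then show ?thesis by (auto intro!: sum.neutral)
      qed
    qed
    also have "\<dots> = (\<Sum>z | C z \<noteq> 0. \<Sum>x | A x \<noteq> 0. \<Sum>w\<in>?W. \<Sum>y | B y \<noteq> 0.
        if w = x \<otimes> y then if w \<otimes> z = g then A x * B y * C z else 0 else 0)"
      by (intro sum.cong refl sum.swap)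
    also have "\<dots> = (\<Sum>z | C z \<noteq> 0. \<Sum>x | A x \<noteq> 0. \<Sum>y | B y \<noteq> 0. \<Sum>w\<in>?W.
        if w = x \<otimes> y then if w \<otimes> z = g then A x * B y * C z else 0 else 0)"
      by (intro sum.cong refl sum.swap)
    also have "\<dots> = (\<Sum>z | C z \<noteq> 0. \<Sum>x | A x \<noteq> 0. \<Sum>y | B y \<noteq> 0.
        if (x \<otimes> y) \<otimes> z = g then A x * B y * C z else 0)"
      by (intro sum.cong refl) (subst sum.delta[OF finW], auto)
    finally show ?thesis .
  qed
  have assoc: "(A \<otimes>\<^bsub>?R\<^esub> B) \<otimes>\<^bsub>?R\<^esub> C = A \<otimes>\<^bsub>?R\<^esub> (B \<otimes>\<^bsub>?R\<^esub> C)"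
    if ABC: "A \<in> carrier ?R" "B \<in> carrier ?R" "C \<in> carrier ?R" for A B C
  proof
    fix g
    have "(A \<otimes>\<^bsub>?R\<^esub> (B \<otimes>\<^bsub>?R\<^esub> C)) g = ((B \<otimes>\<^bsub>?R\<^esub> C) \<otimes>\<^bsub>?R\<^esub> A) g"
      using comm[OF ABC(1) closed[OF ABC(2,3)]] by simp
    also have "\<dots> = (\<Sum>x | A x \<noteq> 0. \<Sum>y | B y \<noteq> 0. \<Sum>z | C z \<noteq> 0.
        if (y \<otimes> z) \<otimes> x = g then B y * C z * A x else 0)"
      by (rule triple[OF ABC(2,3,1)])
    also have "\<dots> = (\<Sum>x | A x \<noteq> 0. \<Sum>y | B y \<noteq> 0. \<Sum>z | C z \<noteq> 0.
        if (x \<otimes> y) \<otimes> z = g then A x * B y * C z else 0)"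
    proof (intro sum.cong refl)
      fix x y z assume "x \<in> {x. A x \<noteq> 0}" "y \<in> {y. B y \<noteq> 0}" "z \<in> {z. C z \<noteq> 0}"
      then have "x \<in> carrier G" "y \<in> carrier G" "z \<in> carrier G" using ABC by (auto simp: car)
      then show "(if (y \<otimes> z) \<otimes> x = g then B y * C z * A x else 0) =
          (if (x \<otimes> y) \<otimes> z = g then A x * B y * C z else 0)"
        by (simp add: m_ac mult.assoc mult.commute mult.left_commute)
    qed
    also have "\<dots> = (\<Sum>x | A x \<noteq> 0. \<Sum>z | C z \<noteq> 0. \<Sum>y | B y \<noteq> 0.
        if (x \<otimes> y) \<otimes> z = g then A x * B y * C z else 0)"
      by (intro sum.cong refl sum.swap)
    also have "\<dots> = (\<Sum>z | C z \<noteq> 0. \<Sum>x | A x \<noteq> 0. \<Sum>y | B y \<noteq> 0.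
        if (x \<otimes> y) \<otimes> z = g then A x * B y * C z else 0)"
      by (rule sum.swap)
    also have "\<dots> = ((A \<otimes>\<^bsub>?R\<^esub> B) \<otimes>\<^bsub>?R\<^esub> C) g"
      by (rule triple[OF ABC, symmetric])
    finally show "((A \<otimes>\<^bsub>?R\<^esub> B) \<otimes>\<^bsub>?R\<^esub> C) g = (A \<otimes>\<^bsub>?R\<^esub> (B \<otimes>\<^bsub>?R\<^esub> C)) g" by simp
  qed
  have add_closed: "A \<oplus>\<^bsub>?R\<^esub> B \<in> carrier ?R" if "A \<in> carrier ?R" "B \<in> carrier ?R" for A B
  proof -
    have sub: "{g. (A \<oplus>\<^bsub>?R\<^esub> B) g \<noteq> 0} \<subseteq> {g. A g \<noteq> 0} \<union> {g. B g \<noteq> 0}"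
      by (auto simp: plus)
    have "finite ({g. A g \<noteq> 0} \<union> {g. B g \<noteq> 0})" "{g. A g \<noteq> 0} \<union> {g. B g \<noteq> 0} \<subseteq> carrier G"
      using that by (auto simp: car)
    then show ?thesis
      unfolding car using sub by (meson finite_subset subset_trans)
  qed
  have zero_closed: "\<zero>\<^bsub>?R\<^esub> \<in> carrier ?R"
    by (simp add: zero car)
  have one_closed: "\<one>\<^bsub>?R\<^esub> \<in> carrier ?R"
    by (auto simp: one car indicator_def)
  have l_one: "\<one>\<^bsub>?R\<^esub> \<otimes>\<^bsub>?R\<^esub> A = A" if A: "A \<in> carrier ?R" for A
  proof
    fix g
    have "(\<one>\<^bsub>?R\<^esub> \<otimes>\<^bsub>?R\<^esub> A) g =
        (\<Sum>x\<in>{\<one>}. \<Sum>y | A y \<noteq> 0. if x \<otimes> y = g then \<one>\<^bsub>?R\<^esub> x * A y else 0)"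
      using A by (intro group_ring_mult) (auto simp: car one indicator_def)
    also have "\<dots> = (\<Sum>y | A y \<noteq> 0. if y = g then A y else 0)"
      using A by (auto simp: one car subset_iff intro!: sum.cong)
    also have "\<dots> = A g"
      using A by (simp add: car sum.delta')
    finally show "(\<one>\<^bsub>?R\<^esub> \<otimes>\<^bsub>?R\<^esub> A) g = A g" .
  qed
  have distr: "(A \<oplus>\<^bsub>?R\<^esub> B) \<otimes>\<^bsub>?R\<^esub> C = A \<otimes>\<^bsub>?R\<^esub> C \<oplus>\<^bsub>?R\<^esub> B \<otimes>\<^bsub>?R\<^esub> C"
    if ABC: "A \<in> carrier ?R" "B \<in> carrier ?R" "C \<in> carrier ?R" for A B C
  proof
    fix g
    let ?X = "{x. A x \<noteq> 0} \<union> {x. B x \<noteq> 0}"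
    have fin: "finite ?X" "finite {z. C z \<noteq> 0}" using ABC by (auto simp: car)
    have *: "(D \<otimes>\<^bsub>?R\<^esub> C) g = (\<Sum>x\<in>?X. \<Sum>z | C z \<noteq> 0. if x \<otimes> z = g then D x * C z else 0)"
      if "{x. D x \<noteq> 0} \<subseteq> ?X" for D
      using that fin by (intro group_ring_mult) auto
    have "((A \<oplus>\<^bsub>?R\<^esub> B) \<otimes>\<^bsub>?R\<^esub> C) g = (\<Sum>x\<in>?X. \<Sum>z | C z \<noteq> 0.
        if x \<otimes> z = g then (A \<oplus>\<^bsub>?R\<^esub> B) x * C z else 0)"
      by (rule *) (auto simp: plus)
    also have "\<dots> = (\<Sum>x\<in>?X. \<Sum>z | C z \<noteq> 0.
        (if x \<otimes> z = g then A x * C z else 0) + (if x \<otimes> z = g then B x * C z else 0))"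
      by (intro sum.cong refl) (simp add: plus distrib_right)
    also have "\<dots> = (A \<otimes>\<^bsub>?R\<^esub> C) g + (B \<otimes>\<^bsub>?R\<^esub> C) g"
      using *[of A] *[of B] by (simp only: sum.distrib Un_upper1 Un_upper2)
    finally show "((A \<oplus>\<^bsub>?R\<^esub> B) \<otimes>\<^bsub>?R\<^esub> C) g = (A \<otimes>\<^bsub>?R\<^esub> C \<oplus>\<^bsub>?R\<^esub> B \<otimes>\<^bsub>?R\<^esub> C) g"
      by (simp add: plus)
  qed
  show ?thesis
  proof (rule cringI)
    show "abelian_group ?R"
    proof (rule abelian_groupI)
      fix A assume "A \<in> carrier ?R"
      then have "(\<lambda>g. - A g) \<in> carrier ?R" by (simp add: car)
      moreover have "(\<lambda>g. - A g) \<oplus>\<^bsub>?R\<^esub> A = \<zero>\<^bsub>?R\<^esub>" by (simp add: plus zero)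
      ultimately show "\<exists>B\<in>carrier ?R. B \<oplus>\<^bsub>?R\<^esub> A = \<zero>\<^bsub>?R\<^esub>" by blast
    next
      show "\<zero>\<^bsub>?R\<^esub> \<in> carrier ?R" by (rule zero_closed)
    next
      fix A B assume "A \<in> carrier ?R" "B \<in> carrier ?R"
      then show "A \<oplus>\<^bsub>?R\<^esub> B \<in> carrier ?R" by (rule add_closed)
    next
      fix A B C
      show "A \<oplus>\<^bsub>?R\<^esub> B \<oplus>\<^bsub>?R\<^esub> C = A \<oplus>\<^bsub>?R\<^esub> (B \<oplus>\<^bsub>?R\<^esub> C)" by (simp add: plus add.assoc)
      show "A \<oplus>\<^bsub>?R\<^esub> B = B \<oplus>\<^bsub>?R\<^esub> A" unfolding plus by (rule ext) (rule add.commute)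
      show "\<zero>\<^bsub>?R\<^esub> \<oplus>\<^bsub>?R\<^esub> A = A" by (simp add: plus zero)
    qed
    show "comm_monoid ?R"
      by (rule comm_monoidI) (rule closed one_closed assoc l_one comm; assumption)+
  qed (rule distr)
qed

lemma group_ring_minus:
  assumes G: "comm_group G" and A: "A \<in> carrier (group_ring G)" and B: "B \<in> carrier (group_ring G)"
  shows "A \<ominus>\<^bsub>group_ring G\<^esub> B = (\<lambda>g. A g - B g)"
proof -
  interpret cring "group_ring G" by (rule group_ring_cring[OF G])
  have "\<ominus>\<^bsub>group_ring G\<^esub> B = (\<lambda>g. - B g)"
  proof (rule minus_equality)
    show "(\<lambda>g. - B g) \<oplus>\<^bsub>group_ring G\<^esub> B = \<zero>\<^bsub>group_ring G\<^esub>" by (simp add: group_ring_def)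
    show "(\<lambda>g. - B g) \<in> carrier (group_ring G)" using B by (simp add: group_ring_def)
  qed (rule B)
  then show ?thesis by (simp add: a_minus_def) (simp add: group_ring_def)
qed

end

(* Put S2 = T0^(2) + T1^(2) and S4 = S2^(2), X0 = S2 T0, X1 = S2 T1, Y = S4 T1.  Since H has odd
   order, squaring is an automorphism; the equations force |T0| = n, |T1| = n + 1, they express
   T0^3 and T1^3 through X0 and X1, and T1^5 through Y, X1 and X0.  As T^p is congruent to T^(p)
   modulo p, outside a set U of at most 5n + 3 elements the coefficients of X0 and X1 are 1 mod 3,
   and that of Y is n (n + 2)^2 + n X1 - X0 mod 5.  The means of X0, X1 and Y are about 2, and
   the second moments force X0, X1 to take the values 1 and 4 almost everywhere, with frequencies
   2/3 and 1/3, and to be uncorrelated.  The residues mod 5 then push the mean of the nonnegative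
   function Y above 2; quadratic minorants of Y in X0 and X1 make this quantitative. *)
theory Submission
  imports Defs "HOL-Algebra.Multiplicative_Group" "HOL-Library.Function_Algebras"
begin

section \<open>Convolution of integer-valued functions\<close>

text \<open>With pointwise operations on functions, \<open>of_int c * f\<close> serves as a scalar
  multiple, so that linear identities in the group ring become ring identities open to
  \<open>algebra_simps\<close>.\<close>

lemma of_int_fun_apply [simp]: "(of_int c :: 'a \<Rightarrow> int) h = c"
  by (cases c) auto

context comm_group
begin

text \<open>The group ring product as a single sum, since \<open>x\<close> determines the other
  factor. The value 0 outside the carrier lets commutativity and associativity hold for all
  functions, without support conditions.\<close>

definition conv :: "('a \<Rightarrow> int) \<Rightarrow> ('a \<Rightarrow> int) \<Rightarrow> 'a \<Rightarrow> int" where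
  "conv f g h = (if h \<in> carrier G then \<Sum>x\<in>carrier G. f x * g (inv x \<otimes> h) else 0)"

lemma conv_add: "conv (f + g) k = conv f k + conv g k"
  "conv k (f + g) = conv k f + conv k g"
  by (auto simp: conv_def fun_eq_iff sum.distrib algebra_simps)

lemma conv_diff: "conv (f - g) k = conv f k - conv g k"
  "conv k (f - g) = conv k f - conv k g"
  by (auto simp: conv_def fun_eq_iff sum_subtractf algebra_simps)

lemma conv_scale: "conv (of_int c * f) k = of_int c * conv f k"
  "conv k (of_int c * f) = of_int c * conv k f"
  by (auto simp: conv_def fun_eq_iff sum_distrib_left algebra_simps)

lemma conv_numeral: "conv (numeral c * f) k = numeral c * conv f k"
  "conv k (numeral c * f) = numeral c * conv k f"
  by (auto simp: conv_def fun_eq_iff sum_distrib_left algebra_simps)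

lemma conv_commute: "conv f g = conv g f"
proof
  fix h
  have "(\<Sum>x\<in>carrier G. f x * g (inv x \<otimes> h)) = (\<Sum>x\<in>carrier G. g x * f (inv x \<otimes> h))"
    if "h \<in> carrier G"
    by (rule sum.reindex_bij_witness[of _ "\<lambda>x. inv x \<otimes> h" "\<lambda>x. inv x \<otimes> h"])
      (use that in \<open>auto simp: inv_mult m_ac\<close>)
  then show "conv f g h = conv g f h" by (simp add: conv_def)
qed

lemma conv_assoc: "conv (conv f g) k = conv f (conv g k)"
proof
  fix h
  show "conv (conv f g) k h = conv f (conv g k) h"
  proof (cases "h \<in> carrier G")
    case h: True
    have cancel: "inv y \<otimes> (y \<otimes> x) = x" "y \<otimes> (x \<otimes> inv y) = x"
      if "x \<in> carrier G" "y \<in> carrier G" for x y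
      using that by (simp_all add: m_assoc[symmetric], simp add: m_assoc m_lcomm)
    have "conv (conv f g) k h =
        (\<Sum>x\<in>carrier G. \<Sum>y\<in>carrier G. f y * g (inv y \<otimes> x) * k (inv x \<otimes> h))"
      using h by (simp add: conv_def sum_distrib_right)
    also have "\<dots> = (\<Sum>y\<in>carrier G. \<Sum>x\<in>carrier G. f y * g (inv y \<otimes> x) * k (inv x \<otimes> h))"
      by (rule sum.swap)
    also have "\<dots> = (\<Sum>y\<in>carrier G. \<Sum>z\<in>carrier G. f y * (g z * k (inv z \<otimes> (inv y \<otimes> h))))"
    proof (rule sum.cong[OF refl])
      fix y assume y: "y \<in> carrier G"
      show "(\<Sum>x\<in>carrier G. f y * g (inv y \<otimes> x) * k (inv x \<otimes> h)) =
          (\<Sum>z\<in>carrier G. f y * (g z * k (inv z \<otimes> (inv y \<otimes> h))))"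
        by (rule sum.reindex_bij_witness[of _ "\<lambda>z. y \<otimes> z" "\<lambda>x. inv y \<otimes> x"])
          (use h y in \<open>auto simp: inv_mult m_ac cancel mult.assoc\<close>)
    qed
    also have "\<dots> = conv f (conv g k) h"
      using h by (simp add: conv_def sum_distrib_left)
    finally show ?thesis .
  qed (simp add: conv_def)
qed

sublocale conv: abel_semigroup conv
  by standard (rule conv_assoc, rule conv_commute)


lemma conv_indicator:
  assumes "finite (carrier G)" "x \<in> carrier G" "y \<in> carrier G"
  shows "conv (indicator {x}) (indicator {y}) = indicator {x \<otimes> y}"
proof
  fix h
  have "inv x \<otimes> h = y \<longleftrightarrow> h = x \<otimes> y" if "h \<in> carrier G"
    using that assms by (auto simp: inv_solve_left')
  then show "conv (indicator {x}) (indicator {y}) h = indicator {x \<otimes> y} h"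
    using assms by (auto simp: conv_def indicator_def if_distrib cong: if_cong)
qed

section \<open>Third and fifth powers modulo 3 and 5\<close>

lemma conv_cube_add: "conv (a + b) (conv (a + b) (a + b)) =
    conv a (conv a a) + conv b (conv b b) + 3 * (conv a (conv a b) + conv a (conv b b))"
  by (simp only: conv_add conv.commute conv.left_commute) (simp add: algebra_simps)

lemma conv_fifth_add: "conv (a + b) (conv (a + b) (conv (a + b) (conv (a + b) (a + b)))) = 
  conv a (conv a (conv a (conv a a))) + conv b (conv b (conv b (conv b b))) + 
  5 * (conv a (conv a (conv a (conv a b))) + 2 * conv a (conv a (conv a (conv b b))) +
    2 * conv a (conv a (conv b (conv b b))) + conv a (conv b (conv b (conv b b))))"
  by (simp only: conv_add conv.commute conv.left_commute) (simp add: algebra_simps)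


text \<open>Frobenius modulo 3, by inserting the points of \<open>T\<close> one at a time: the mixed
  terms of \<open>conv_cube_add\<close> are multiples of 3, and the cube of the single point
  \<open>x\<close> is concentrated at the third power of \<open>x\<close>, which \<open>h\<close>
  avoids. Cubing need not be injective on \<open>T\<close>.\<close>

lemma dvd_conv_cube_indicator:
  assumes fin: "finite (carrier G)" and "T \<subseteq> carrier G" "finite T" "h \<in> carrier G" "h \<notin> (\<lambda>x. x \<otimes> (x \<otimes> x)) ` T"
  shows "3 dvd conv (indicator T) (conv (indicator T) (indicator T)) h"
  using assms(3,2,5)
proof (induction T rule: finite_induct)
  case empty
  then show ?case by (simp add: conv_def)
next
  case (insert x T)
  have split: "indicator (insert x T) = indicator {x} + (indicator T :: 'a \<Rightarrow> int)"
    using insert.hyps by (auto simp: fun_eq_iff indicator_def)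
  moreover have "conv (indicator {x}) (conv (indicator {x}) (indicator {x})) h = 0"
    using insert.prems assms(4) by (simp add: conv_indicator fin)
  ultimately show ?case
    using insert unfolding split conv_cube_add by simp
qed

text \<open>The same induction modulo 5, with the inner binomial coefficients 5, 10, 10, 5 of
  \<open>conv_fifth_add\<close>.\<close>

lemma dvd_conv_fifth_indicator:
  assumes fin: "finite (carrier G)" and "T \<subseteq> carrier G" "finite T" "h \<in> carrier G"
    "h \<notin> (\<lambda>x. x \<otimes> (x \<otimes> (x \<otimes> (x \<otimes> x)))) ` T"
  defines "t \<equiv> indicator T"
  shows "5 dvd conv t (conv t (conv t (conv t t))) h"
  using assms(3,2,5) unfolding t_def
proof (induction T rule: finite_induct)
  case empty
  then show ?case by (simp add: conv_def)
next
  case (insert x T)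
  have split: "indicator (insert x T) = indicator {x} + (indicator T :: 'a \<Rightarrow> int)"
    using insert.hyps by (auto simp: fun_eq_iff indicator_def)
  moreover have "conv (indicator {x}) (conv (indicator {x}) (conv (indicator {x})
      (conv (indicator {x}) (indicator {x})))) h = 0"
    using insert.prems assms(4) by (simp add: conv_indicator fin)
  ultimately show ?case
    using insert unfolding split conv_fifth_add by simp
qed


section \<open>Sums, symmetry and the coefficient at the identity\<close>

lemma conv_nonneg: "(\<And>x. f x \<ge> 0) \<Longrightarrow> (\<And>x. g x \<ge> 0) \<Longrightarrow> conv f g h \<ge> 0"
  by (simp add: conv_def sum_nonneg)

lemma conv_at_one: "conv f g \<one> = (\<Sum>x\<in>carrier G. f x * g (inv x))"
  by (simp add: conv_def)

lemma conv_one: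
  assumes "finite (carrier G)" "\<And>x. x \<notin> carrier G \<Longrightarrow> f x = 0"
  shows "conv f (indicator {\<one>}) = f"
proof -
  have "conv (indicator {\<one>}) f h = f h" for h
  proof -
    have "(\<Sum>x\<in>carrier G. indicator {\<one>} x * f (inv x \<otimes> h)) =
        (\<Sum>x\<in>carrier G. if x = \<one> then f (inv x \<otimes> h) else 0)"
      by (intro sum.cong) (auto simp: indicator_def)
    then show ?thesis
      using assms by (simp add: conv_def)
  qed
  then show ?thesis by (simp add: conv_commute[of f] fun_eq_iff)
qed

lemma sum_translate:
  "y \<in> carrier G \<Longrightarrow> (\<Sum>x\<in>carrier G. f (inv y \<otimes> x)) = (\<Sum>x\<in>carrier G. f x)"
  for f :: "'a \<Rightarrow> int"
  by (rule sum.reindex_bij_witness[of _ "\<lambda>x. y \<otimes> x" "\<lambda>x. inv y \<otimes> x"])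
    (auto simp: m_assoc[symmetric])

lemma sum_inv: "(\<Sum>x\<in>carrier G. f (inv x)) = (\<Sum>x\<in>carrier G. f x)"
  for f :: "'a \<Rightarrow> int"
  by (rule sum.reindex_bij_witness[of _ "\<lambda>x. inv x" "\<lambda>x. inv x"]) auto

lemma sum_conv: "(\<Sum>h\<in>carrier G. conv f g h) = (\<Sum>h\<in>carrier G. f h) * (\<Sum>h\<in>carrier G. g h)"
proof -
  have "(\<Sum>h\<in>carrier G. conv f g h) =
      (\<Sum>h\<in>carrier G. \<Sum>x\<in>carrier G. f x * g (inv x \<otimes> h))"
    by (simp add: conv_def)
  also have "\<dots> = (\<Sum>x\<in>carrier G. \<Sum>h\<in>carrier G. f x * g (inv x \<otimes> h))"
    by (rule sum.swap)
  also have "\<dots> = (\<Sum>x\<in>carrier G. f x * (\<Sum>h\<in>carrier G. g h))"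
    by (intro sum.cong) (simp_all add: sum_distrib_left[symmetric] sum_translate)
  finally show ?thesis by (simp add: sum_distrib_right)
qed

lemma conv_carrier:
  "conv f (indicator (carrier G)) = of_int (\<Sum>x\<in>carrier G. f x) * indicator (carrier G)"
  by (auto simp: fun_eq_iff conv_def simp del: of_int_sum)

definition symmetric_fun :: "('a \<Rightarrow> int) \<Rightarrow> bool" where
  "symmetric_fun f \<longleftrightarrow> (\<forall>x\<in>carrier G. f (inv x) = f x)"

lemma symmetric_fun_conv:
  assumes "symmetric_fun f" "symmetric_fun g"
  shows "symmetric_fun (conv f g)"
  unfolding symmetric_fun_def
proof
  fix h assume h: "h \<in> carrier G"
  have "conv f g (inv h) = (\<Sum>x\<in>carrier G. f (inv x) * g (inv (inv x) \<otimes> inv h))"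
    using h by (simp add: conv_def sum_inv[of "\<lambda>x. f x * g (inv x \<otimes> inv h)", symmetric])
  also have "\<dots> = (\<Sum>x\<in>carrier G. f x * g (inv x \<otimes> h))"
  proof (rule sum.cong[OF refl])
    fix x assume x: "x \<in> carrier G"
    have "g (inv (inv x \<otimes> h)) = g (inv x \<otimes> h)"
      using assms h x by (simp add: symmetric_fun_def)
    then show "f (inv x) * g (inv (inv x) \<otimes> inv h) = f x * g (inv x \<otimes> h)"
      using assms h x by (simp add: symmetric_fun_def inv_mult)
  qed
  finally show "conv f g (inv h) = conv f g h"
    using h by (simp add: conv_def)
qed

text \<open>Makes the coefficient at the identity an inner product. Applied to a square it gives a
  second moment, applied to indicators the size of an intersection.\<close>

lemma conv_at_one_symmetric:
  "symmetric_fun g \<Longrightarrow> conv f g \<one> = (\<Sum>x\<in>carrier G. f x * g x)"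
  by (simp add: conv_at_one symmetric_fun_def)

lemma group_ring_mult_conv:
  assumes "finite (carrier G)" "\<And>x. x \<notin> carrier G \<Longrightarrow> f x = 0" "\<And>x. x \<notin> carrier G \<Longrightarrow> g x = 0"
  shows "f \<otimes>\<^bsub>group_ring G\<^esub> g = conv f g"
proof
  fix h
  have eq: "x \<otimes> y = h \<longleftrightarrow> h \<in> carrier G \<and> y = inv x \<otimes> h"
    if "x \<in> carrier G" "y \<in> carrier G" for x y
    using that by (auto simp: m_assoc[symmetric])
  have "(f \<otimes>\<^bsub>group_ring G\<^esub> g) h =
      (\<Sum>x\<in>carrier G. \<Sum>y\<in>carrier G. if x \<otimes> y = h then f x * g y else 0)"
    using assms by (intro group_ring_mult) auto
  also have "\<dots> = (\<Sum>x\<in>carrier G. \<Sum>y\<in>carrier G.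
      if y = inv x \<otimes> h then if h \<in> carrier G then f x * g y else 0 else 0)"
    by (intro sum.cong refl) (simp add: eq)
  also have "\<dots> = conv f g h"
    using assms(1) by (auto simp: conv_def intro!: sum.neutral)
  finally show "(f \<otimes>\<^bsub>group_ring G\<^esub> g) h = conv f g h" .
qed

end

lemma group_ring_add_pow: "([k] \<cdot>\<^bsub>group_ring G\<^esub> f) = of_nat k * f" for k :: nat
  by (induction k) (auto simp: add_pow_def group_ring_def fun_eq_iff algebra_simps)

section \<open>Odd order: square roots and dilation\<close>

locale odd_comm_group = comm_group +
  assumes odd_order: "odd (order G)"
begin

lemma finite_carrier: "finite (carrier G)"
  using odd_order order_gt_0_iff_finite by (metis even_zero gr0I)

text \<open>In a group of odd order m the power (m + 1) / 2 is the unique square root. As a power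
  map it is visibly an endomorphism.\<close>

definition half :: "'a \<Rightarrow> 'a" where
  "half x = x [^] ((order G + 1) div 2)"

lemma half_closed [simp]: "x \<in> carrier G \<Longrightarrow> half x \<in> carrier G"
  by (simp add: half_def)

lemma half_mult: "x \<in> carrier G \<Longrightarrow> y \<in> carrier G \<Longrightarrow> half (x \<otimes> y) = half x \<otimes> half y"
  by (simp add: half_def pow_mult_distrib[OF m_comm])

lemma half_inv: "x \<in> carrier G \<Longrightarrow> half (inv x) = inv (half x)"
  by (simp add: half_def nat_pow_inv)

lemma half_one: "half \<one> = \<one>"
  by (simp add: half_def)

lemma half_mult_half: "x \<in> carrier G \<Longrightarrow> half x \<otimes> half x = x"
proof -
  assume x: "x \<in> carrier G"
  have "half x \<otimes> half x = x [^] ((order G + 1) div 2 + (order G + 1) div 2)"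
    unfolding half_def using x by (rule nat_pow_mult)
  also have "(order G + 1) div 2 + (order G + 1) div 2 = order G + 1"
    using odd_order by presburger
  finally have "half x \<otimes> half x = x [^] (order G + 1)" .
  then show ?thesis
    using x by (simp add: pow_order_eq_1)
qed

lemma half_square: "x \<in> carrier G \<Longrightarrow> half (x \<otimes> x) = x"
  by (simp add: half_mult half_mult_half)

lemma eq_square_iff: "x \<in> carrier G \<Longrightarrow> y \<in> carrier G \<Longrightarrow> x \<otimes> x = y \<longleftrightarrow> x = half y"
  by (auto simp: half_mult_half half_square)

text \<open>The image under squaring, written as a pullback along the inverse map.\<close>

definition dilate :: "('a \<Rightarrow> int) \<Rightarrow> 'a \<Rightarrow> int" where
  "dilate f h = (if h \<in> carrier G then f (half h) else 0)"

lemma sum_half: "(\<Sum>x\<in>carrier G. f (half x)) = (\<Sum>x\<in>carrier G. f x)"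
  for f :: "'a \<Rightarrow> int"
  by (rule sum.reindex_bij_witness[of _ "\<lambda>x. x \<otimes> x" half])
    (auto simp: half_mult_half half_square)

lemma sum_dilate: "(\<Sum>x\<in>carrier G. dilate f x) = (\<Sum>x\<in>carrier G. f x)"
  by (simp add: dilate_def sum_half)

lemma dilate_linear:
  "dilate (f + g) = dilate f + dilate g" "dilate (f - g) = dilate f - dilate g"
  "dilate (of_int c * f) = of_int c * dilate f" "dilate (numeral k * f) = numeral k * dilate f"
  by (auto simp: dilate_def fun_eq_iff)

lemma dilate_carrier: "dilate (indicator (carrier G)) = indicator (carrier G)"
  by (auto simp: dilate_def fun_eq_iff indicator_def)

lemma dilate_one: "dilate (indicator {\<one>}) = indicator {\<one>}"
  using half_one half_mult_half by (force simp: dilate_def fun_eq_iff indicator_def)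

lemma dilate_nonneg: "(\<And>x. f x \<ge> 0) \<Longrightarrow> dilate f h \<ge> 0"
  by (simp add: dilate_def)

lemma symmetric_fun_dilate: "symmetric_fun f \<Longrightarrow> symmetric_fun (dilate f)"
  by (simp add: symmetric_fun_def dilate_def half_inv)

lemma dilate_conv: "dilate (conv f g) = conv (dilate f) (dilate g)"
proof
  fix h
  show "dilate (conv f g) h = conv (dilate f) (dilate g) h"
    using sum_half[of "\<lambda>x. f x * g (inv x \<otimes> half h)"]
    by (simp add: dilate_def conv_def half_mult half_inv)
qed

text \<open>Squaring is injective, so the fibre over \<open>h\<close> contains at most the point
  \<open>half h\<close> and no coefficients are added up.\<close>

lemma power_map_2_indicator:
  assumes "T \<subseteq> carrier G"
  shows "power_map G 2 (indicator T) = dilate (indicator T)"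
proof
  fix h
  have sq: "x [^] (2::int) = x \<otimes> x" if "x \<in> carrier G" for x
    using that int_pow_int[of G x 2] by (simp add: numeral_2_eq_2)
  have "{x. (indicator T x :: int) \<noteq> 0 \<and> x [^] (2::int) = h} = (if half h \<in> T \<and> h \<in> carrier G then {half h} else {})"
    using assms by (auto simp: indicator_def sq half_square half_mult_half subset_iff)
  then show "power_map G 2 (indicator T) h = dilate (indicator T) h"
    by (auto simp: power_map_def dilate_def)
qed

lemma symmetric_fun_indicator:
  assumes "T \<subseteq> carrier G" "inverse_closed G T"
  shows "symmetric_fun (indicator T)"
  unfolding symmetric_fun_def
proof
  fix h assume h: "h \<in> carrier G"
  have pow: "x [^] (-1::int) = inv x" if "x \<in> carrier G" for x
    using that int_pow_neg[of x 1] by (simp add: int_pow_1)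
  have "{x. (indicator T x :: int) \<noteq> 0 \<and> x [^] (-1::int) = h} = (if inv h \<in> T then {inv h} else {})"
    using assms h by (auto simp: indicator_def pow subset_iff)
  then have "power_map G (-1) (indicator T) h = indicator T (inv h)"
    by (auto simp: power_map_def)
  then show "indicator T (inv h) = (indicator T h :: int)"
    using assms(2) by (simp add: inverse_closed_def)
qed

text \<open>In odd order only the identity is its own inverse, so \<open>T\<close> splits into
  two-element classes of the form x, inv x. This parity later decides which of T0 and T1 has n
  elements.\<close>

lemma even_card_inverse_closed:
  assumes "T \<subseteq> carrier G" "symmetric_fun (indicator T)" "\<one> \<notin> T"
  shows "even (card T)"
proof -
  have inv: "inv x \<in> T" if "x \<in> T" for x
    using that assms by (force simp: symmetric_fun_def indicator_def split: if_splits)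
  have ne: "inv x \<noteq> x" if "x \<in> T" for x
  proof
    assume "inv x = x"
    then have "x \<otimes> x = \<one>" using that assms by (metis r_inv subsetD)
    then have "x = \<one>" using that assms eq_square_iff[of x \<one>] half_one by auto
    then show False using that assms by simp
  qed
  have fin: "finite T" using assms finite_carrier finite_subset by blast
  let ?C = "(\<lambda>x. {x, inv x}) ` T"
  have "2 * card ?C = card (\<Union>?C)"
  proof (rule card_partition)
    have "card {x, inv x} = 2" if "x \<in> T" for x
      using ne[OF that, THEN not_sym] by simp
    then show "card c = 2" if "c \<in> ?C" for c
      using that by auto
    show "c \<inter> d = {}" if "c \<in> ?C" "d \<in> ?C" "c \<noteq> d" for c d
      using that assms(1) by (auto simp: subset_iff)
  qed (use fin inv in auto)
  moreover have "\<Union>?C = T" using inv by auto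
  ultimately show ?thesis by (metis dvd_triv_left)
qed


section \<open>Consequences of the two equations\<close>

text \<open>Write J for the sum of the carrier and e for the identity. Replacing \<open>P\<close>
  squared by means of \<open>squares\<close> leaves the term P Q^2 = (J - e) Q = q J - Q. The roles
  of \<open>P\<close> and \<open>Q\<close> are kept abstract so that T0 and T1 can be
  exchanged.\<close>

lemma conv_cube:
  fixes n :: int
  assumes supp: "\<And>x. x \<notin> carrier G \<Longrightarrow> P x = 0" "\<And>x. x \<notin> carrier G \<Longrightarrow> Q x = 0"
    and prod: "conv P Q = indicator (carrier G) - indicator {\<one>}"
    and squares: "conv P P + conv Q Q = 2 * indicator (carrier G) - s + of_int (2 * n) * indicator {\<one>}"
    and sums: "(\<Sum>x\<in>carrier G. P x) = p" "(\<Sum>x\<in>carrier G. Q x) = q"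
  shows "conv P (conv P P) =
    of_int (2 * p - q) * indicator (carrier G) - conv s P + of_int (2 * n) * P + Q"
proof -
  have unit: "conv P (indicator {\<one>}) = P" "conv Q (indicator {\<one>}) = Q"
    by (simp_all add: conv_one finite_carrier supp)
  have PP: "conv P P = 2 * indicator (carrier G) - s + of_int (2 * n) * indicator {\<one>} - conv Q Q"
    using squares by (simp add: eq_diff_eq)
  have "conv P (conv P P) = 2 * conv P (indicator (carrier G)) - conv P s
      + of_int (2 * n) * conv P (indicator {\<one>}) - conv (conv P Q) Q"
    by (simp only: PP conv_add conv_diff conv_numeral conv_scale conv_assoc)
  also have "conv (conv P Q) Q = conv Q (indicator (carrier G)) - conv Q (indicator {\<one>})"
    by (simp only: prod conv_diff conv.commute)
  also have "2 * conv P (indicator (carrier G)) - conv P s + of_int (2 * n) * conv P (indicator {\<one>})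
      - (conv Q (indicator (carrier G)) - conv Q (indicator {\<one>})) =
    of_int (2 * p - q) * indicator (carrier G) - conv s P + of_int (2 * n) * P + Q"
    by (simp only: conv_carrier unit sums conv.commute[of P s]) (simp add: algebra_simps)
  finally show ?thesis .
qed

text \<open>Multiply the cube formula by P^2 and reduce each term again. The term P^2 (s P) equals s
  P^3, where the cube formula applies once more, and the resulting s^2 P is removed by
  \<open>ss\<close>. The summand 5 p collects 4 p from s^2 P and p from P^2 Q.\<close>

lemma conv_fifth:
  fixes n :: int
  assumes supp: "\<And>x. x \<notin> carrier G \<Longrightarrow> P x = 0" "\<And>x. x \<notin> carrier G \<Longrightarrow> Q x = 0"
    and prod: "conv P Q = indicator (carrier G) - indicator {\<one>}"
    and squares: "conv P P + conv Q Q = 2 * indicator (carrier G) - s + of_int (2 * n) * indicator {\<one>}"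
    and sums: "(\<Sum>x\<in>carrier G. P x) = p" "(\<Sum>x\<in>carrier G. Q x) = q"
    and sum_s: "(\<Sum>x\<in>carrier G. s x) = p + q"
    and ss: "conv s s = 4 * indicator (carrier G) + of_int (2 * n - 2) * indicator {\<one>} - s'"
  shows "conv P (conv P (conv P (conv P P))) =
    of_int ((2 * p - q) * (p\<^sup>2 - (p + q) + 2 * n) + 5 * p) * indicator (carrier G)
    - conv s' P - of_int (4 * n) * conv s P - conv s Q
    + of_int (4 * n\<^sup>2 + 2 * n - 3) * P + of_int (2 * n) * Q"
proof -
  let ?J = "indicator (carrier G) :: 'a \<Rightarrow> int" and ?e = "indicator {\<one>} :: 'a \<Rightarrow> int"
  have J: "conv f ?J = of_int (\<Sum>x\<in>carrier G. f x) * ?J" for f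
    by (rule conv_carrier)
  have unit: "conv P ?e = P" "conv Q ?e = Q"
    by (simp_all add: conv_one finite_carrier supp)
  have cube: "conv P (conv P P) =
    of_int (2 * p - q) * indicator (carrier G) - conv s P + of_int (2 * n) * P + Q"
    by (rule conv_cube) (fact assms)+
  have s_X: "conv s (conv s P) = of_int (4 * p) * ?J + of_int (2 * n - 2) * P - conv s' P"
  proof -
    have "conv s (conv s P) = conv (conv s s) P"
      by (simp only: conv_assoc)
    also have "\<dots> = 4 * conv P ?J + of_int (2 * n - 2) * conv P ?e - conv s' P"
      by (simp only: ss conv_add conv_diff conv_numeral conv_scale conv.commute[of _ P])
    finally show ?thesis by (simp add: J unit sums algebra_simps)
  qed
  have PPX: "conv P (conv P (conv s P)) = of_int ((2 * p - q) * (p + q)) * ?J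
      - conv s (conv s P) + of_int (2 * n) * conv s P + conv s Q"
  proof -
    have "conv P (conv P (conv s P)) = conv s (conv P (conv P P))"
      by (simp only: conv.left_commute)
    also have "\<dots> = of_int (2 * p - q) * conv s ?J
      - conv s (conv s P) + of_int (2 * n) * conv s P + conv s Q"
      by (simp only: cube conv_add conv_diff conv_scale)
    finally show ?thesis by (simp only: J sum_s) (simp add: algebra_simps)
  qed
  have PPQ: "conv P (conv P Q) = of_int p * ?J - P"
    by (simp only: prod conv_diff J unit sums)
  have PPJ: "conv P (conv P ?J) = of_int (p * p) * ?J"
    by (simp only: J conv_scale sums) (simp add: algebra_simps)
  have "conv P (conv P (conv P (conv P P))) = of_int (2 * p - q) * conv P (conv P ?J)
      - conv P (conv P (conv s P)) + of_int (2 * n) * conv P (conv P P) + conv P (conv P Q)"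
    by (simp only: cube conv_add conv_diff conv_scale)
  also have "\<dots> = of_int ((2 * p - q) * (p\<^sup>2 - (p + q) + 2 * n) + 5 * p) * ?J
    - conv s' P - of_int (4 * n) * conv s P - conv s Q
    + of_int (4 * n\<^sup>2 + 2 * n - 3) * P + of_int (2 * n) * Q"
    unfolding PPQ PPJ PPX cube s_X
    by (simp add: algebra_simps power2_eq_square)
  finally show ?thesis .
qed

text \<open>By symmetry the left side is the coefficient of s^2 V^2 at the identity, and
  \<open>ss\<close> evaluates it up to the inner product of \<open>s'\<close> with V^2. Only a lower
  bound for V^2 is then required; -1 rather than 0 is allowed so that \<open>V\<close> may be the
  difference of the two indicators.\<close>

lemma sum_square_conv_le:
  fixes n :: int
  assumes "symmetric_fun s" "symmetric_fun V" "symmetric_fun s'"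
    and supp: "\<And>x. x \<notin> carrier G \<Longrightarrow> V x = 0"
    and ss: "conv s s = 4 * indicator (carrier G) + of_int (2 * n - 2) * indicator {\<one>} - s'"
    and "\<And>x. s' x \<ge> 0" and VV: "\<And>h. h \<in> carrier G \<Longrightarrow> conv V V h \<ge> -1"
  shows "(\<Sum>h\<in>carrier G. (conv s V h)\<^sup>2) \<le>
    4 * (\<Sum>x\<in>carrier G. V x)\<^sup>2 + (2 * n - 2) * (\<Sum>x\<in>carrier G. (V x)\<^sup>2) + (\<Sum>x\<in>carrier G. s' x)"
proof -
  let ?W = "conv V V"
  have sym: "symmetric_fun ?W" "symmetric_fun (conv s V)"
    using assms by (auto intro: symmetric_fun_conv)
  have "(\<Sum>h\<in>carrier G. (conv s V h)\<^sup>2) = conv (conv s V) (conv s V) \<one>"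
    using sym by (simp add: conv_at_one_symmetric power2_eq_square)
  also have "conv (conv s V) (conv s V) = conv (conv s s) ?W"
    by (simp only: conv.commute conv.left_commute conv_assoc)
  also have "conv (conv s s) ?W = 4 * conv ?W (indicator (carrier G))
      + of_int (2 * n - 2) * conv ?W (indicator {\<one>}) - conv s' ?W"
    by (simp only: ss conv_add conv_diff conv_numeral conv_scale conv.commute[of _ ?W])
  also have "\<dots> \<one> = 4 * (\<Sum>x\<in>carrier G. ?W x) + (2 * n - 2) * ?W \<one> - conv s' ?W \<one>"
    by (simp add: conv_carrier conv_one[where f = ?W] conv_def[of V V] finite_carrier del: of_int_sum)
  also have "\<dots> = 4 * (\<Sum>x\<in>carrier G. V x)\<^sup>2 + (2 * n - 2) * (\<Sum>x\<in>carrier G. (V x)\<^sup>2)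
      - (\<Sum>x\<in>carrier G. s' x * ?W x)"
    using sym assms(2) by (simp add: conv_at_one_symmetric sum_conv power2_eq_square)
  finally have *: "(\<Sum>h\<in>carrier G. (conv s V h)\<^sup>2) = 4 * (\<Sum>x\<in>carrier G. V x)\<^sup>2
      + (2 * n - 2) * (\<Sum>x\<in>carrier G. (V x)\<^sup>2) - (\<Sum>x\<in>carrier G. s' x * ?W x)" .
  have "- (\<Sum>x\<in>carrier G. s' x * ?W x) \<le> (\<Sum>x\<in>carrier G. s' x)"
  proof -
    have "- (s' x * ?W x) \<le> s' x" if "x \<in> carrier G" for x
      using mult_left_mono[OF VV[OF that] assms(6)[of x]] by simp
    then show ?thesis by (simp add: sum_negf[symmetric] sum_mono)
  qed
  with * show ?thesis by simp
qed

end

section \<open>Exceptional points and quadratic minorants\<close>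

text \<open>Here \<open>w\<close> is a minorant of \<open>k * Y\<close> only off \<open>U\<close>.
  On \<open>U\<close> the uniform bound \<open>m\<close> is paid instead, which costs at most
  \<open>m * c\<close> because \<open>Y\<close> is nonnegative.\<close>

lemma sum_le_exceptional:
  fixes w Y :: "'a \<Rightarrow> int"
  assumes "finite C" "U \<subseteq> C" "int (card U) \<le> c" "0 \<le> m"
    and "\<And>h. h \<in> C \<Longrightarrow> 0 \<le> Y h" "\<And>h. h \<in> C \<Longrightarrow> w h \<le> m"
    and "\<And>h. h \<in> C - U \<Longrightarrow> w h \<le> k * Y h" "0 \<le> k"
  shows "(\<Sum>h\<in>C. w h) \<le> k * (\<Sum>h\<in>C. Y h) + m * c"
proof -
  have "(\<Sum>h\<in>C. w h) \<le> (\<Sum>h\<in>C. k * Y h + m * indicator U h)"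
  proof (rule sum_mono)
    fix h assume h: "h \<in> C"
    then have "0 \<le> k * Y h" using assms by simp
    then show "w h \<le> k * Y h + m * indicator U h"
      using h assms(6,7)[of h] by (cases "h \<in> U") auto
  qed
  also have "\<dots> = k * (\<Sum>h\<in>C. Y h) + m * int (card U)"
    using assms(1,2) by (simp add: sum.distrib sum_distrib_left[symmetric] indicator_def sum.If_cases Int_absorb1 Int_absorb2 Int_def[symmetric])
  also have "m * int (card U) \<le> m * c"
    using assms by (intro mult_left_mono)
  finally show ?thesis by simp
qed


text \<open>Each left-hand side interpolates \<open>18 r\<close> on \<open>X, Z \<in> {1, 4}\<close>, where \<open>r\<close> is the least
  nonnegative residue of \<open>Y\<close> modulo 5, and is a lower bound at all larger values.\<close>

lemma bound_mod5_1:
  fixes X Z Y :: int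
  assumes "3 dvd X - 1" "3 dvd Z - 1" "0 \<le> Y" "5 dvd 4 - Y + Z - X"
  shows "72 - 3 * (X - Z) - 5 * (X - Z)\<^sup>2 \<le> 18 * Y"
proof -
  have "3 dvd X - Z" using assms by presburger
  then obtain d where d: "X - Z = 3 * d" by (rule dvdE)
  have "5 dvd 4 - Y - 3 * d" using assms(4) d by presburger
  \<comment> \<open>For \<open>X\<close> and \<open>Z\<close> in {1, 4} only d = -1, 0, 1 occur.
    Beyond them the quadratic is negative, and there \<open>0 \<le> Y\<close> suffices without any
    residue.\<close>
  moreover have "d = -1 \<or> d = 0 \<or> d = 1 \<or> 72 - 9 * d - 45 * d\<^sup>2 \<le> 0"
  proof -
    consider "d \<ge> 2" | "d \<le> -2" | "d = -1 \<or> d = 0 \<or> d = 1" by linarith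
    then show ?thesis
    proof cases
      case 1
      then have "2 * d \<le> d\<^sup>2" by (simp add: power2_eq_square mult_right_mono)
      with 1 show ?thesis by linarith
    next
      case 2
      then have "2 * - d \<le> - d * - d" by (intro mult_right_mono) auto
      then have "2 * - d \<le> d\<^sup>2" by (simp add: power2_eq_square)
      with 2 show ?thesis by linarith
    qed blast
  qed
  ultimately show ?thesis
    unfolding d using assms(3) by (elim disjE) (simp_all, presburger+)
qed

lemma bound_mod5_4:
  fixes X Z Y :: int
  assumes "3 dvd X - 1" "3 dvd Z - 1" "0 \<le> X" "0 \<le> Z" "0 \<le> Y" "5 dvd 4 - Y - Z - X"
  shows "47 * (X + Z) - 5 * (X + Z)\<^sup>2 - 38 \<le> 18 * Y"
proof -
  have "3 dvd X + Z - 2" using assms by presburger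
  then obtain s where s: "X + Z = 3 * s + 2" by (auto elim!: dvdE simp: algebra_simps)
  have 5: "5 dvd 4 - Y - (3 * s + 2)" "0 \<le> s" using assms s by presburger+
  have eq: "47 * (X + Z) - 5 * (X + Z)\<^sup>2 - 38 = 36 + 81 * s - 45 * s\<^sup>2"
    unfolding s by (simp add: power2_eq_square algebra_simps)
  consider "s = 0" | "s = 1" | "s = 2" | "s \<ge> 3" using 5 by linarith
  then show ?thesis
  proof cases
    case 4
    then have "3 * s \<le> s\<^sup>2" by (simp add: power2_eq_square mult_right_mono)
    then show ?thesis unfolding eq using 4 assms(5) by linarith
  qed (use 5 assms(5) in \<open>unfold eq, simp_all, presburger+\<close>)
qed

lemma bound_mod5_2:
  fixes X Z Y :: int
  assumes "3 dvd X - 1" "3 dvd Z - 1" "0 \<le> X" "0 \<le> Z" "0 \<le> Y" "5 dvd 2 - Y + 2 * Z - X"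
  shows "46 - 18 * X + 31 * Z - 5 * Z\<^sup>2 \<le> 18 * Y"
proof -
  obtain x z where xz: "X = 3 * x + 1" "Z = 3 * z + 1"
    using assms(1,2) by (auto elim!: dvdE simp: algebra_simps)
  have 5: "5 dvd 3 - Y + 6 * z - 3 * x" "0 \<le> x" "0 \<le> z" using assms xz by presburger+
  have eq: "46 - 18 * X + 31 * Z - 5 * Z\<^sup>2 = 54 - 54 * x + 63 * z - 45 * z\<^sup>2"
    unfolding xz by (simp add: power2_eq_square algebra_simps)
  consider "z = 0" | "z = 1" | "z \<ge> 2" using 5 by linarith
  then show ?thesis
  proof cases
    case 3
    then have "2 * z \<le> z\<^sup>2" by (simp add: power2_eq_square mult_right_mono)
    then show ?thesis unfolding eq using 3 5(2) assms(5) by linarith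
  qed (use 5 assms(5) in \<open>simp_all add: eq, presburger+\<close>)
qed

lemma bound_mod5_3:
  fixes X Z Y :: int
  assumes "3 dvd X - 1" "3 dvd Z - 1" "0 \<le> X" "0 \<le> Z" "0 \<le> Y" "5 dvd 3 * Z - X - Y"
  shows "10 + 37 * X - 6 * Z - 5 * X\<^sup>2 \<le> 18 * Y"
proof -
  obtain x z where xz: "X = 3 * x + 1" "Z = 3 * z + 1"
    using assms(1,2) by (auto elim!: dvdE simp: algebra_simps)
  have 5: "5 dvd 2 + 9 * z - 3 * x - Y" "0 \<le> x" "0 \<le> z" using assms xz by presburger+
  have eq: "10 + 37 * X - 6 * Z - 5 * X\<^sup>2 = 36 + 81 * x - 18 * z - 45 * x\<^sup>2"
    unfolding xz by (simp add: power2_eq_square algebra_simps)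
  \<comment> \<open>The value x = 2, that is X = 7, lies outside the interpolation points, but the
    quadratic still equals 18 there for z = 0. The residue then forces Y >= 1, so equality can
    occur.\<close>
  consider "x = 0" | "x = 1" | "x = 2" | "x \<ge> 3" using 5 by linarith
  then show ?thesis
  proof cases
    case 4
    then have "3 * x \<le> x\<^sup>2" by (simp add: power2_eq_square mult_right_mono)
    then show ?thesis unfolding eq using 4 5(3) assms(5) by linarith
  qed (use 5 assms(5) in \<open>simp_all add: eq, presburger+\<close>)
qed

text \<open>On the exceptional set nothing is known modulo 3, so the minorants are bounded over all
  integers by completing squares. The largest real maximum is 46 + 31^2 / 20 = 94.05, in the third
  one; 95 serves for all four.\<close>

lemma quadratic_le_95:
  fixes x :: int
  shows "72 - 3 * x - 5 * x\<^sup>2 \<le> 95" "47 * x - 5 * x\<^sup>2 - 38 \<le> 95"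
    "46 + 31 * x - 5 * x\<^sup>2 \<le> 95" "10 + 37 * x - 5 * x\<^sup>2 \<le> 95"
  using zero_le_power2[of "10 * x + 3"] zero_le_power2[of "10 * x - 47"]
    zero_le_power2[of "10 * x - 31"] zero_le_power2[of "10 * x - 37"]
  by (simp_all add: power2_eq_square algebra_simps)


section \<open>The hypothetical pair: sizes and moments\<close>

text \<open>The equations of the theorem in terms of \<open>conv\<close> and \<open>dilate\<close>.
  The residues of n modulo 3 and 5 are left out, since sizes and moments are derived from oddness
  alone.\<close>

locale lee_pair = odd_comm_group +
  fixes n :: nat and T\<^sub>0 T\<^sub>1 :: "'a set"
  assumes order_eq: "order G = n\<^sup>2 + n + 1" and odd_n: "odd n"
    and sub: "T\<^sub>0 \<subseteq> carrier G" "T\<^sub>1 \<subseteq> carrier G"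
    and sym: "symmetric_fun (indicator T\<^sub>0)" "symmetric_fun (indicator T\<^sub>1)"
    and one_in: "\<one> \<in> T\<^sub>0"
    and prod: "conv (indicator T\<^sub>0) (indicator T\<^sub>1) = indicator (carrier G) - indicator {\<one>}"
    and squares: "conv (indicator T\<^sub>0) (indicator T\<^sub>0) + conv (indicator T\<^sub>1) (indicator T\<^sub>1) =
      2 * indicator (carrier G) - (dilate (indicator T\<^sub>0) + dilate (indicator T\<^sub>1))
      + of_int (2 * int n) * indicator {\<one>}"
begin

abbreviation "t\<^sub>0 \<equiv> indicator T\<^sub>0 :: 'a \<Rightarrow> int"
abbreviation "t\<^sub>1 \<equiv> indicator T\<^sub>1 :: 'a \<Rightarrow> int"

definition "s\<^sub>2 = dilate t\<^sub>0 + dilate t\<^sub>1"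
definition "s\<^sub>4 = dilate s\<^sub>2"
definition "X\<^sub>0 = conv s\<^sub>2 t\<^sub>0"
definition "X\<^sub>1 = conv s\<^sub>2 t\<^sub>1"
definition "Y = conv s\<^sub>4 t\<^sub>1"

lemma supp: "x \<notin> carrier G \<Longrightarrow> t\<^sub>0 x = 0" "x \<notin> carrier G \<Longrightarrow> t\<^sub>1 x = 0"
  using sub by (auto simp: indicator_def)

lemma finite_T: "finite T\<^sub>0" "finite T\<^sub>1"
  using sub finite_carrier finite_subset by blast+

lemma sum_t: "(\<Sum>x\<in>carrier G. t\<^sub>0 x) = int (card T\<^sub>0)" "(\<Sum>x\<in>carrier G. t\<^sub>1 x) = int (card T\<^sub>1)"
  using sub finite_carrier
  by (simp_all add: indicator_def sum.If_cases Int_absorb1 Int_absorb2 Int_def[symmetric])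

text \<open>By symmetry the coefficient of T0 T1 at the identity counts the common elements, and
  that of H - e is 0.\<close>

lemma disjoint: "T\<^sub>0 \<inter> T\<^sub>1 = {}"
proof -
  have "(\<Sum>x\<in>carrier G. t\<^sub>0 x * t\<^sub>1 x) = 0"
    using fun_cong[OF prod, of \<one>] by (simp add: conv_at_one_symmetric sym)
  then have "\<forall>x\<in>carrier G. t\<^sub>0 x * t\<^sub>1 x = 0"
    by (subst (asm) sum_nonneg_eq_0_iff) (auto simp: finite_carrier)
  then show ?thesis using sub by (auto simp: indicator_def split: if_splits)
qed

lemma one_notin: "\<one> \<notin> T\<^sub>1"
  using disjoint one_in by blast

text \<open>The squares equation at the identity gives the sum of the two sizes, the total of the
  product equation gives their product n^2 + n. So the sizes are n and n + 1, and |T1| is even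
  because T1 omits the identity.\<close>

lemma card_T: "card T\<^sub>0 = n" "card T\<^sub>1 = n + 1"
proof -
  let ?p = "int (card T\<^sub>0)" and ?q = "int (card T\<^sub>1)"
  have sq: "t\<^sub>0 x * t\<^sub>0 x = t\<^sub>0 x" "t\<^sub>1 x * t\<^sub>1 x = t\<^sub>1 x" for x
    by (auto simp: indicator_def)
  \<comment> \<open>The right side is 2 - 1 + 2n: the dilated T0 contains the identity and the
    dilated T1 does not.\<close>
  have sum_pq: "?p + ?q = 2 * int n + 1"
    using fun_cong[OF squares, of \<one>] one_in one_notin
    by (simp add: conv_at_one_symmetric sym sq sum_t dilate_def half_one)
  have "?p * ?q = (int n)\<^sup>2 + int n"
  proof -
    have "?p * ?q = (\<Sum>h\<in>carrier G. conv t\<^sub>0 t\<^sub>1 h)"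
      by (simp add: sum_conv sum_t)
    also have "\<dots> = (\<Sum>h\<in>carrier G. 1) - (\<Sum>h\<in>carrier G. if h = \<one> then 1 else 0)"
      by (simp only: prod sum_subtractf[symmetric]) (auto intro!: sum.cong simp: indicator_def)
    also have "\<dots> = int (order G) - 1"
      by (simp add: finite_carrier order_def)
    finally show ?thesis by (simp add: order_eq)
  qed
  then have "?p * (2 * int n + 1 - ?p) = (int n)\<^sup>2 + int n"
    by (simp flip: sum_pq)
  then have "(?p - int n) * (?p - int n - 1) = 0"
    by (simp add: power2_eq_square algebra_simps)
  then have "?p = int n \<or> ?p = int n + 1" by auto
  moreover have "even (card T\<^sub>1)"
    using even_card_inverse_closed sub sym one_notin by blast
  ultimately show "card T\<^sub>0 = n" "card T\<^sub>1 = n + 1"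
    using sum_pq odd_n by auto
qed

lemma sum_s: "(\<Sum>x\<in>carrier G. s\<^sub>2 x) = 2 * int n + 1" "(\<Sum>x\<in>carrier G. s\<^sub>4 x) = 2 * int n + 1"
  by (simp_all add: s\<^sub>2_def s\<^sub>4_def sum_dilate sum.distrib sum_t card_T)

lemma symmetric_s: "symmetric_fun s\<^sub>2" "symmetric_fun s\<^sub>4"
proof -
  show "symmetric_fun s\<^sub>2"
    using symmetric_fun_dilate[OF sym(1)] symmetric_fun_dilate[OF sym(2)]
    by (simp add: s\<^sub>2_def symmetric_fun_def)
  then show "symmetric_fun s\<^sub>4" by (simp add: s\<^sub>4_def symmetric_fun_dilate)
qed

lemma s_bounds: "0 \<le> s\<^sub>2 x" "0 \<le> s\<^sub>4 x" "s\<^sub>2 x \<le> 1"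
proof -
  show nonneg: "0 \<le> s\<^sub>2 x" for x by (simp add: s\<^sub>2_def dilate_nonneg)
  then show "0 \<le> s\<^sub>4 x" by (simp add: s\<^sub>4_def dilate_nonneg)
  show "s\<^sub>2 x \<le> 1" using disjoint by (auto simp: s\<^sub>2_def dilate_def indicator_def)
qed

text \<open>Adding twice the product equation to the squares equation gives the square of T0 + T1.
  Dilation is multiplicative and fixes both H and e, so it carries this identity over to
  \<open>s\<^sub>2\<close>.\<close>

lemma conv_s\<^sub>2_s\<^sub>2: "conv s\<^sub>2 s\<^sub>2 =
  4 * indicator (carrier G) + of_int (2 * int n - 2) * indicator {\<one>} - s\<^sub>4"
proof -
  let ?J = "indicator (carrier G) :: 'a \<Rightarrow> int" and ?e = "indicator {\<one>} :: 'a \<Rightarrow> int"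
  have "conv s\<^sub>2 s\<^sub>2 = dilate (conv (t\<^sub>0 + t\<^sub>1) (t\<^sub>0 + t\<^sub>1))"
    by (simp add: dilate_conv dilate_linear s\<^sub>2_def)
  also have "conv (t\<^sub>0 + t\<^sub>1) (t\<^sub>0 + t\<^sub>1) =
      (conv t\<^sub>0 t\<^sub>0 + conv t\<^sub>1 t\<^sub>1) + 2 * conv t\<^sub>0 t\<^sub>1"
    by (simp only: conv_add conv.commute[of t\<^sub>1 t\<^sub>0]) (simp add: algebra_simps)
  also have "\<dots> = 4 * ?J + of_int (2 * int n - 2) * ?e - s\<^sub>2"
    unfolding squares prod s\<^sub>2_def by (simp add: algebra_simps)
  finally show ?thesis
    by (simp only: s\<^sub>4_def dilate_linear dilate_carrier dilate_one)
qed

lemma sum_XY: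
  "(\<Sum>h\<in>carrier G. X\<^sub>0 h) = (2 * int n + 1) * int n"
  "(\<Sum>h\<in>carrier G. X\<^sub>1 h) = (2 * int n + 1) * (int n + 1)"
  "(\<Sum>h\<in>carrier G. Y h) = (2 * int n + 1) * (int n + 1)"
  by (simp_all add: X\<^sub>0_def X\<^sub>1_def Y_def sum_conv sum_s sum_t card_T)

lemma XY_nonneg: "0 \<le> X\<^sub>0 h" "0 \<le> X\<^sub>1 h" "0 \<le> Y h"
  unfolding X\<^sub>0_def X\<^sub>1_def Y_def by (rule conv_nonneg; simp add: s_bounds)+

lemma card_carrier: "int (card (carrier G)) = (int n)\<^sup>2 + int n + 1"
  using order_eq by (simp add: order_def)

text \<open>One moment for each quadratic minorant: n = 3, 2, 4, 1 modulo 5, in this order.\<close>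

lemma sum_square_X:
  "(\<Sum>h\<in>carrier G. (X\<^sub>0 h)\<^sup>2) \<le> 6 * (int n)\<^sup>2 + 1"
  "(\<Sum>h\<in>carrier G. (X\<^sub>1 h)\<^sup>2) \<le> 6 * (int n)\<^sup>2 + 10 * int n + 3"
  "(\<Sum>h\<in>carrier G. (X\<^sub>0 h + X\<^sub>1 h)\<^sup>2) \<le> 20 * (int n)\<^sup>2 + 16 * int n + 3"
  "(\<Sum>h\<in>carrier G. (X\<^sub>0 h - X\<^sub>1 h)\<^sup>2) \<le> 4 * (int n)\<^sup>2 + 3"
proof -
  note bound = sum_square_conv_le[OF symmetric_s(1) _ symmetric_s(2) _ conv_s\<^sub>2_s\<^sub>2 s_bounds(2),
      unfolded sum_s]
  have sq: "(t\<^sub>0 x)\<^sup>2 = t\<^sub>0 x" "(t\<^sub>1 x)\<^sup>2 = t\<^sub>1 x" for x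
    by (auto simp: indicator_def)
  have sq': "(t\<^sub>0 x + t\<^sub>1 x)\<^sup>2 = t\<^sub>0 x + t\<^sub>1 x" "(t\<^sub>0 x - t\<^sub>1 x)\<^sup>2 = t\<^sub>0 x + t\<^sub>1 x" for x
    using disjoint by (auto simp: indicator_def)
  have ge: "- 1 \<le> conv f g h" if "\<And>x. 0 \<le> f x" "\<And>x. 0 \<le> g x" for f g h
    using conv_nonneg[of f g h] that by simp
  show "(\<Sum>h\<in>carrier G. (X\<^sub>0 h)\<^sup>2) \<le> 6 * (int n)\<^sup>2 + 1"
    using bound[OF sym(1) supp(1) ge] unfolding X\<^sub>0_def sq sum_t card_T
    by (simp add: power2_eq_square algebra_simps)
  show "(\<Sum>h\<in>carrier G. (X\<^sub>1 h)\<^sup>2) \<le> 6 * (int n)\<^sup>2 + 10 * int n + 3"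
    using bound[OF sym(2) supp(2) ge] unfolding X\<^sub>1_def sq sum_t card_T
    by (simp add: power2_eq_square algebra_simps)
  have "symmetric_fun (t\<^sub>0 + t\<^sub>1)" using sym by (simp add: symmetric_fun_def)
  then have "(\<Sum>h\<in>carrier G. (conv s\<^sub>2 (t\<^sub>0 + t\<^sub>1) h)\<^sup>2) \<le> 4 * (\<Sum>x\<in>carrier G. (t\<^sub>0 + t\<^sub>1) x)\<^sup>2
      + (2 * int n - 2) * (\<Sum>x\<in>carrier G. ((t\<^sub>0 + t\<^sub>1) x)\<^sup>2) + (2 * int n + 1)"
    by (rule bound) (auto simp: supp intro: ge)
  then show "(\<Sum>h\<in>carrier G. (X\<^sub>0 h + X\<^sub>1 h)\<^sup>2) \<le> 20 * (int n)\<^sup>2 + 16 * int n + 3"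
    by (simp add: X\<^sub>0_def X\<^sub>1_def conv_add sq' sum.distrib sum_t card_T)
      (simp add: power2_eq_square algebra_simps)
  \<comment> \<open>The difference T0 - T1 has an almost diagonal square. Its negative coefficients
    come from \<open>s\<^sub>2\<close>, which is at most 1 by disjointness; hence the bound
    -1.\<close>
  have VV: "conv (t\<^sub>0 - t\<^sub>1) (t\<^sub>0 - t\<^sub>1) = of_int (2 * int n + 2) * indicator {\<one>} - s\<^sub>2"
  proof -
    have "conv (t\<^sub>0 - t\<^sub>1) (t\<^sub>0 - t\<^sub>1) = (conv t\<^sub>0 t\<^sub>0 + conv t\<^sub>1 t\<^sub>1) - 2 * conv t\<^sub>0 t\<^sub>1"
      by (simp only: conv_diff conv.commute[of t\<^sub>1 t\<^sub>0]) (simp add: algebra_simps)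
    also have "\<dots> = of_int (2 * int n + 2) * indicator {\<one>} - s\<^sub>2"
      unfolding squares prod s\<^sub>2_def by (simp add: algebra_simps)
    finally show ?thesis .
  qed
  have "symmetric_fun (t\<^sub>0 - t\<^sub>1)" using sym by (simp add: symmetric_fun_def)
  then have "(\<Sum>h\<in>carrier G. (conv s\<^sub>2 (t\<^sub>0 - t\<^sub>1) h)\<^sup>2) \<le> 4 * (\<Sum>x\<in>carrier G. (t\<^sub>0 - t\<^sub>1) x)\<^sup>2
      + (2 * int n - 2) * (\<Sum>x\<in>carrier G. ((t\<^sub>0 - t\<^sub>1) x)\<^sup>2) + (2 * int n + 1)"
  proof (rule bound)
    show "- 1 \<le> conv (t\<^sub>0 - t\<^sub>1) (t\<^sub>0 - t\<^sub>1) h" for h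
      using s_bounds(3)[of h] by (auto simp: VV indicator_def)
  qed (simp add: supp)
  then show "(\<Sum>h\<in>carrier G. (X\<^sub>0 h - X\<^sub>1 h)\<^sup>2) \<le> 4 * (int n)\<^sup>2 + 3"
    by (simp add: X\<^sub>0_def X\<^sub>1_def conv_diff sq' sum.distrib sum_subtractf sum_t card_T)
      (simp add: power2_eq_square algebra_simps)
qed

section \<open>The exceptional set and the congruences\<close>

definition "cubes = (\<lambda>x. x \<otimes> (x \<otimes> x)) ` (T\<^sub>0 \<union> T\<^sub>1)"
definition "fifths = (\<lambda>x. x \<otimes> (x \<otimes> (x \<otimes> (x \<otimes> x)))) ` T\<^sub>1"
text \<open>Off \<open>U\<close> the terms \<open>t\<^sub>0\<close> and \<open>t\<^sub>1\<close> of
  the power formulas vanish and the Frobenius lemmas apply. Only T1 is raised to the fifth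
  power.\<close>

definition "U = T\<^sub>0 \<union> T\<^sub>1 \<union> cubes \<union> fifths"

lemma U_subset: "U \<subseteq> carrier G"
  using sub by (auto simp: U_def cubes_def fifths_def subset_iff)

text \<open>2 (2n + 1) + (n + 1), with images counted by their sources.\<close>

lemma card_U: "int (card U) \<le> 5 * int n + 3"
proof -
  have "card U \<le> card (T\<^sub>0 \<union> T\<^sub>1) + card cubes + card fifths"
    unfolding U_def by (meson card_Un_le add_mono order_trans order_refl)
  moreover have "card cubes \<le> card (T\<^sub>0 \<union> T\<^sub>1)" "card fifths \<le> card T\<^sub>1"
    unfolding cubes_def fifths_def using finite_T by (auto intro: card_image_le)
  moreover have "card (T\<^sub>0 \<union> T\<^sub>1) \<le> 2 * n + 1"
    using card_Un_le[of T\<^sub>0 T\<^sub>1] by (simp add: card_T)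
  ultimately show ?thesis by (simp add: card_T)
qed

lemma squares': "conv t\<^sub>1 t\<^sub>1 + conv t\<^sub>0 t\<^sub>0 =
    2 * indicator (carrier G) - s\<^sub>2 + of_int (2 * int n) * indicator {\<one>}"
  using squares by (simp only: s\<^sub>2_def add.commute)

lemma prod': "conv t\<^sub>1 t\<^sub>0 = indicator (carrier G) - indicator {\<one>}"
  using prod by (simp only: conv.commute)

text \<open>Off \<open>U\<close> the cube formula leaves n - 1 - X0 and n + 2 - X1, both divisible
  by 3. For n = 2 modulo 3 either constant is 1.\<close>

lemma X_mod_3:
  assumes h: "h \<in> carrier G - U" and n: "[int n = 2] (mod 3)"
  shows "3 dvd X\<^sub>0 h - 1" "3 dvd X\<^sub>1 h - 1"
proof -
  have n': "3 dvd int n - 2" using n by (simp add: cong_iff_dvd_diff)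
  have h': "t\<^sub>0 h = 0" "t\<^sub>1 h = 0" using h by (auto simp: U_def)
  have "conv t\<^sub>0 (conv t\<^sub>0 t\<^sub>0) = of_int (2 * int n - (int n + 1)) * indicator (carrier G)
      - conv s\<^sub>2 t\<^sub>0 + of_int (2 * int n) * t\<^sub>0 + t\<^sub>1"
    by (rule conv_cube) (simp_all add: supp prod squares s\<^sub>2_def sum_t card_T)
  moreover have "3 dvd conv t\<^sub>0 (conv t\<^sub>0 t\<^sub>0) h"
    by (rule dvd_conv_cube_indicator) (use h sub finite_T finite_carrier in \<open>auto simp: U_def cubes_def\<close>)
  ultimately have "3 dvd int n - 1 - X\<^sub>0 h"
    using h h' by (simp add: X\<^sub>0_def)
  then show "3 dvd X\<^sub>0 h - 1" using n' by presburger
  have "conv t\<^sub>1 (conv t\<^sub>1 t\<^sub>1) = of_int (2 * (int n + 1) - int n) * indicator (carrier G)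
      - conv s\<^sub>2 t\<^sub>1 + of_int (2 * int n) * t\<^sub>1 + t\<^sub>0"
    by (rule conv_cube) (simp_all add: supp prod' squares' sum_t card_T)
  moreover have "3 dvd conv t\<^sub>1 (conv t\<^sub>1 t\<^sub>1) h"
    by (rule dvd_conv_cube_indicator) (use h sub finite_T finite_carrier in \<open>auto simp: U_def cubes_def\<close>)
  ultimately have "3 dvd int n + 2 - X\<^sub>1 h"
    using h h' by (simp add: X\<^sub>1_def)
  then show "3 dvd X\<^sub>1 h - 1" using n' by presburger
qed

text \<open>The fifth-power formula for T1 off \<open>U\<close>. The parameter \<open>r\<close>
  allows a numeral to replace n in each residue class, leaving a linear congruence.\<close>

lemma Y_mod_5:
  assumes h: "h \<in> carrier G - U" and n: "[int n = r] (mod 5)"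
  shows "5 dvd r * (r + 2)\<^sup>2 - Y h - 4 * r * X\<^sub>1 h - X\<^sub>0 h"
proof -
  have h': "t\<^sub>0 h = 0" "t\<^sub>1 h = 0" using h by (auto simp: U_def)
  let ?K = "(2 * (int n + 1) - int n) * ((int n + 1)\<^sup>2 - (int n + 1 + int n) + 2 * int n) + 5 * (int n + 1)"
  have "conv t\<^sub>1 (conv t\<^sub>1 (conv t\<^sub>1 (conv t\<^sub>1 t\<^sub>1))) = of_int ?K * indicator (carrier G)
      - conv s\<^sub>4 t\<^sub>1 - of_int (4 * int n) * conv s\<^sub>2 t\<^sub>1 - conv s\<^sub>2 t\<^sub>0
      + of_int (4 * (int n)\<^sup>2 + 2 * int n - 3) * t\<^sub>1 + of_int (2 * int n) * t\<^sub>0"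
    by (rule conv_fifth)
      (simp_all add: supp prod' squares' sum_t card_T sum_s conv_s\<^sub>2_s\<^sub>2)
  moreover have "5 dvd conv t\<^sub>1 (conv t\<^sub>1 (conv t\<^sub>1 (conv t\<^sub>1 t\<^sub>1))) h"
    by (rule dvd_conv_fifth_indicator) (use h sub finite_T finite_carrier in \<open>auto simp: U_def fifths_def\<close>)
  ultimately have "5 dvd ?K - Y h - 4 * int n * X\<^sub>1 h - X\<^sub>0 h"
    using h h' by (simp add: X\<^sub>0_def X\<^sub>1_def Y_def del: of_int_add of_int_mult of_int_diff)
  \<comment> \<open>With p = n + 1 and q = n the inner factor is (n + 1)^2 - 1 = n (n + 2).\<close>
  moreover have "?K = int n * (int n + 2)\<^sup>2 + 5 * (int n + 1)"
    by (simp add: power2_eq_square algebra_simps)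
  ultimately have "5 dvd (int n * (int n + 2)\<^sup>2 - Y h - 4 * int n * X\<^sub>1 h - X\<^sub>0 h) + 5 * (int n + 1)"
    by (simp add: algebra_simps)
  then have "5 dvd int n * (int n + 2)\<^sup>2 - Y h - 4 * int n * X\<^sub>1 h - X\<^sub>0 h"
    by (subst (asm) dvd_add_left_iff) auto
  moreover have "[int n * (int n + 2)\<^sup>2 - Y h - 4 * int n * X\<^sub>1 h - X\<^sub>0 h =
      r * (r + 2)\<^sup>2 - Y h - 4 * r * X\<^sub>1 h - X\<^sub>0 h] (mod 5)"
    by (intro cong_diff cong_mult cong_pow cong_add cong_refl n)
  ultimately show ?thesis by (simp add: cong_dvd_iff)
qed

section \<open>Contradiction in each residue class modulo 5\<close>

text \<open>The right side is 18 (2n + 1)(n + 1) + 95 (5n + 3): the total of 18 \<open>Y\<close>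
  plus the cost of the exceptional set.\<close>

lemma sum_weight_le:
  assumes "\<And>h. h \<in> carrier G \<Longrightarrow> w h \<le> 95" "\<And>h. h \<in> carrier G - U \<Longrightarrow> w h \<le> 18 * Y h"
  shows "(\<Sum>h\<in>carrier G. w h) \<le> 36 * (int n)\<^sup>2 + 529 * int n + 303"
  using sum_le_exceptional[OF finite_carrier U_subset card_U, of 95 Y w 18] assms XY_nonneg
  by (simp add: sum_XY power2_eq_square algebra_simps)

lemma no_pair:
  assumes n3: "[int n = 2] (mod 3)"
    and n5: "(n \<ge> 25 \<and> [int n = 0] (mod 5)) \<or>
         (n \<ge> 207 \<and> [int n = 1] (mod 5)) \<or>
         (n \<ge> 114 \<and> [int n = 2] (mod 5)) \<or>
         (n \<ge> 154 \<and> [int n = 3] (mod 5)) \<or>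
         (n \<ge> 232 \<and> [int n = 4] (mod 5))"
  shows False
proof -
  note X3 = X_mod_3[OF _ n3]
  have square_ge: "k * int n \<le> (int n)\<^sup>2" if "k \<le> int n" for k
    using that by (simp add: power2_eq_square mult_right_mono)
  note sums = sum.distrib sum_subtractf sum_distrib_left[symmetric] sum_constant card_carrier sum_XY
  consider "n \<ge> 25" "[int n = 0] (mod 5)" | "n \<ge> 207" "[int n = 1] (mod 5)" | "n \<ge> 114" "[int n = 2] (mod 5)"
    | "n \<ge> 154" "[int n = 3] (mod 5)" | "n \<ge> 232" "[int n = 4] (mod 5)"
    using n5 by blast
  then show False
  proof cases
    case 1
    \<comment> \<open>Here X0 + Y is divisible by 5, and it is positive off \<open>U\<close> because
      X0 is 1 modulo 3. The linear minorant 5 - X0 has mean about 3, against about 2 for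
      \<open>Y\<close>, so no second moment enters.\<close>
    have "(\<Sum>h\<in>carrier G. 5 - X\<^sub>0 h) \<le> 1 * (\<Sum>h\<in>carrier G. Y h) + 5 * (5 * int n + 3)"
    proof (rule sum_le_exceptional[OF finite_carrier U_subset card_U])
      show "5 - X\<^sub>0 h \<le> 1 * Y h" if h: "h \<in> carrier G - U" for h
      proof -
        have "5 dvd X\<^sub>0 h + Y h" using Y_mod_5[OF h 1(2)] by presburger
        moreover have "X\<^sub>0 h \<noteq> 0" using X3(1)[OF h] by auto
        ultimately have "5 \<le> X\<^sub>0 h + Y h" using XY_nonneg[of h] by (intro zdvd_imp_le) auto
        then show ?thesis by simp
      qed
    qed (use XY_nonneg in auto)
    then have "(int n)\<^sup>2 \<le> 24 * int n + 11"
      by (simp add: sums) (simp add: power2_eq_square algebra_simps)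
    then show False using 1(1) square_ge[of 25] by linarith
  next
    case 2
    have "(\<Sum>h\<in>carrier G. 72 - 3 * (X\<^sub>0 h - X\<^sub>1 h) - 5 * (X\<^sub>0 h - X\<^sub>1 h)\<^sup>2) \<le> 36 * (int n)\<^sup>2 + 529 * int n + 303"
    proof (rule sum_weight_le)
      show "72 - 3 * (X\<^sub>0 h - X\<^sub>1 h) - 5 * (X\<^sub>0 h - X\<^sub>1 h)\<^sup>2 \<le> 18 * Y h" if h: "h \<in> carrier G - U" for h
      proof (rule bound_mod5_1)
        show "5 dvd 4 - Y h + X\<^sub>1 h - X\<^sub>0 h" using Y_mod_5[OF h 2(2)] by simp presburger
      qed (use X3[OF h] XY_nonneg in auto)
    qed (rule quadratic_le_95)
    \<comment> \<open>The minorant has constant term 72, twice the 36 on the right, which leaves 36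
      n^2. The moment of X0 - X1 contributes only 20 n^2, so 16 n^2 would be bounded linearly in n.
      The next two cases leave 6 n^2 in the same way.\<close>
    then have "36 * (int n)\<^sup>2 \<le> 451 * int n + 228 + 5 * (\<Sum>h\<in>carrier G. (X\<^sub>0 h - X\<^sub>1 h)\<^sup>2)"
      by (simp add: sums) (simp add: power2_eq_square algebra_simps)
    then show False using 2(1) square_ge[of 207] sum_square_X(4) by linarith
  next
    case 3
    have "(\<Sum>h\<in>carrier G. 46 - 18 * X\<^sub>0 h + 31 * X\<^sub>1 h - 5 * (X\<^sub>1 h)\<^sup>2) \<le> 36 * (int n)\<^sup>2 + 529 * int n + 303"
    proof (rule sum_weight_le)
      show "46 - 18 * X\<^sub>0 h + 31 * X\<^sub>1 h - 5 * (X\<^sub>1 h)\<^sup>2 \<le> 18 * Y h" if h: "h \<in> carrier G - U" for h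
      proof (rule bound_mod5_2)
        show "5 dvd 2 - Y h + 2 * X\<^sub>1 h - X\<^sub>0 h" using Y_mod_5[OF h 3(2)] by simp presburger
      qed (use X3[OF h] XY_nonneg in auto)
      \<comment> \<open>The term in X0 is nonpositive, which reduces the bound to one
        variable.\<close>
      show "46 - 18 * X\<^sub>0 h + 31 * X\<^sub>1 h - 5 * (X\<^sub>1 h)\<^sup>2 \<le> 95" for h
        using quadratic_le_95(3)[of "X\<^sub>1 h"] XY_nonneg(1)[of h] by linarith
    qed
    then have "36 * (int n)\<^sup>2 \<le> 408 * int n + 226 + 5 * (\<Sum>h\<in>carrier G. (X\<^sub>1 h)\<^sup>2)"
      by (simp add: sums) (simp add: power2_eq_square algebra_simps)
    then show False using 3(1) square_ge[of 114] sum_square_X(2) by linarith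
  next
    case 4
    have "(\<Sum>h\<in>carrier G. 10 + 37 * X\<^sub>0 h - 6 * X\<^sub>1 h - 5 * (X\<^sub>0 h)\<^sup>2) \<le> 36 * (int n)\<^sup>2 + 529 * int n + 303"
    proof (rule sum_weight_le)
      show "10 + 37 * X\<^sub>0 h - 6 * X\<^sub>1 h - 5 * (X\<^sub>0 h)\<^sup>2 \<le> 18 * Y h" if h: "h \<in> carrier G - U" for h
      proof (rule bound_mod5_3)
        show "5 dvd 3 * X\<^sub>1 h - X\<^sub>0 h - Y h" using Y_mod_5[OF h 4(2)] by simp presburger
      qed (use X3[OF h] XY_nonneg in auto)
      show "10 + 37 * X\<^sub>0 h - 6 * X\<^sub>1 h - 5 * (X\<^sub>0 h)\<^sup>2 \<le> 95" for h
        using quadratic_le_95(4)[of "X\<^sub>0 h"] XY_nonneg(2)[of h] by linarith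
    qed
    then have "36 * (int n)\<^sup>2 \<le> 500 * int n + 299 + 5 * (\<Sum>h\<in>carrier G. (X\<^sub>0 h)\<^sup>2)"
      by (simp add: sums) (simp add: power2_eq_square algebra_simps)
    then show False using 4(1) square_ge[of 154] sum_square_X(1) by linarith
  next
    case 5
    have "(\<Sum>h\<in>carrier G. 47 * (X\<^sub>0 h + X\<^sub>1 h) - 5 * (X\<^sub>0 h + X\<^sub>1 h)\<^sup>2 - 38) \<le> 36 * (int n)\<^sup>2 + 529 * int n + 303"
    proof (rule sum_weight_le)
      show "47 * (X\<^sub>0 h + X\<^sub>1 h) - 5 * (X\<^sub>0 h + X\<^sub>1 h)\<^sup>2 - 38 \<le> 18 * Y h" if h: "h \<in> carrier G - U" for h
      proof (rule bound_mod5_4)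
        show "5 dvd 4 - Y h - X\<^sub>1 h - X\<^sub>0 h" using Y_mod_5[OF h 5(2)] by simp presburger
      qed (use X3[OF h] XY_nonneg in auto)
    qed (rule quadratic_le_95)
    \<comment> \<open>114 = 47 * 4 - 38 - 36, as X0 + X1 has total (2n + 1)^2. The moment
      contributes 100 n^2, and 14 n^2 remains.\<close>
    then have "114 * (int n)\<^sup>2 \<le> 379 * int n + 294 + 5 * (\<Sum>h\<in>carrier G. (X\<^sub>0 h + X\<^sub>1 h)\<^sup>2)"
      by (simp add: sums) (simp add: power2_eq_square algebra_simps)
    then show False using 5(1) square_ge[of 232] sum_square_X(3) by linarith
  qed
qed

end

section \<open>Transfer from the group ring\<close>

theorem theorem6p6:
  fixes n :: nat and H :: "('a, 'b) monoid_scheme"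
  assumes "n > 0" and "odd n" and "[n = 2] (mod 3)"
    and "(n \<ge> 19 \<and> [n = 0] (mod 5)) \<or>
         (n \<ge> 207 \<and> [n = 1] (mod 5)) \<or>
         (n \<ge> 114 \<and> [n = 2] (mod 5)) \<or>
         (n \<ge> 154 \<and> [n = 3] (mod 5)) \<or>
         (n \<ge> 232 \<and> [n = 4] (mod 5))"
    and "comm_group H" and "order H = n^2 + n + 1"
  shows "\<not> (\<exists>T\<^sub>0 T\<^sub>1. T\<^sub>0 \<subseteq> carrier H \<and> T\<^sub>1 \<subseteq> carrier H \<and>
    inverse_closed H T\<^sub>0 \<and> inverse_closed H T\<^sub>1 \<and> \<one>\<^bsub>H\<^esub> \<in> T\<^sub>0 \<and>
    indicator T\<^sub>0 \<otimes>\<^bsub>group_ring H\<^esub> indicator T\<^sub>1 =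
      indicator (carrier H) \<ominus>\<^bsub>group_ring H\<^esub> \<one>\<^bsub>group_ring H\<^esub> \<and>
    indicator T\<^sub>0 [^]\<^bsub>group_ring H\<^esub> (2::nat) \<oplus>\<^bsub>group_ring H\<^esub> indicator T\<^sub>1 [^]\<^bsub>group_ring H\<^esub> (2::nat) =
      [(2::nat)] \<cdot>\<^bsub>group_ring H\<^esub> indicator (carrier H)
        \<ominus>\<^bsub>group_ring H\<^esub> power_map H 2 (indicator T\<^sub>0)
        \<ominus>\<^bsub>group_ring H\<^esub> power_map H 2 (indicator T\<^sub>1)
        \<oplus>\<^bsub>group_ring H\<^esub> [(2 * n)] \<cdot>\<^bsub>group_ring H\<^esub> \<one>\<^bsub>group_ring H\<^esub>)"
proof
  let ?R = "group_ring H"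
  let ?J = "indicator (carrier H) :: 'a \<Rightarrow> int" and ?e = "indicator {\<one>\<^bsub>H\<^esub>} :: 'a \<Rightarrow> int"
  assume "\<exists>T\<^sub>0 T\<^sub>1. T\<^sub>0 \<subseteq> carrier H \<and> T\<^sub>1 \<subseteq> carrier H \<and>
    inverse_closed H T\<^sub>0 \<and> inverse_closed H T\<^sub>1 \<and> \<one>\<^bsub>H\<^esub> \<in> T\<^sub>0 \<and>
    indicator T\<^sub>0 \<otimes>\<^bsub>?R\<^esub> indicator T\<^sub>1 = ?J \<ominus>\<^bsub>?R\<^esub> \<one>\<^bsub>?R\<^esub> \<and>
    indicator T\<^sub>0 [^]\<^bsub>?R\<^esub> (2::nat) \<oplus>\<^bsub>?R\<^esub> indicator T\<^sub>1 [^]\<^bsub>?R\<^esub> (2::nat) =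
      [(2::nat)] \<cdot>\<^bsub>?R\<^esub> ?J
        \<ominus>\<^bsub>?R\<^esub> power_map H 2 (indicator T\<^sub>0)
        \<ominus>\<^bsub>?R\<^esub> power_map H 2 (indicator T\<^sub>1)
        \<oplus>\<^bsub>?R\<^esub> [(2 * n)] \<cdot>\<^bsub>?R\<^esub> \<one>\<^bsub>?R\<^esub>"
  then obtain T\<^sub>0 T\<^sub>1 where T: "T\<^sub>0 \<subseteq> carrier H" "T\<^sub>1 \<subseteq> carrier H"
      "inverse_closed H T\<^sub>0" "inverse_closed H T\<^sub>1" "\<one>\<^bsub>H\<^esub> \<in> T\<^sub>0"
    and prod: "indicator T\<^sub>0 \<otimes>\<^bsub>?R\<^esub> indicator T\<^sub>1 = ?J \<ominus>\<^bsub>?R\<^esub> \<one>\<^bsub>?R\<^esub>"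
    and squares: "indicator T\<^sub>0 [^]\<^bsub>?R\<^esub> (2::nat) \<oplus>\<^bsub>?R\<^esub> indicator T\<^sub>1 [^]\<^bsub>?R\<^esub> (2::nat) =
      [(2::nat)] \<cdot>\<^bsub>?R\<^esub> ?J
        \<ominus>\<^bsub>?R\<^esub> power_map H 2 (indicator T\<^sub>0)
        \<ominus>\<^bsub>?R\<^esub> power_map H 2 (indicator T\<^sub>1)
        \<oplus>\<^bsub>?R\<^esub> [(2 * n)] \<cdot>\<^bsub>?R\<^esub> \<one>\<^bsub>?R\<^esub>"
    by blast
  interpret H: comm_group H by fact
  interpret H: odd_comm_group H
    \<comment> \<open>n^2 + n is always even, so the order is odd.\<close>
    by standard (simp add: \<open>order H = _\<close>)
  interpret R: cring ?R by (rule group_ring_cring) fact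
  have one: "\<one>\<^bsub>?R\<^esub> = ?e" and plus: "f \<oplus>\<^bsub>?R\<^esub> g = f + g" for f g
    by (auto simp: group_ring_def fun_eq_iff)
  have in_R: "f \<in> carrier ?R" if "\<And>x. x \<notin> carrier H \<Longrightarrow> f x = 0" for f
    using that H.finite_carrier by (auto simp: group_ring_def intro: finite_subset[of _ "carrier H"])
  have minus: "f \<ominus>\<^bsub>?R\<^esub> g = f - g" if "f \<in> carrier ?R" "g \<in> carrier ?R" for f g
    using group_ring_minus[OF \<open>comm_group H\<close> that] by (simp add: fun_eq_iff)
  have ind: "indicator T \<in> carrier ?R" "H.dilate (indicator T) \<in> carrier ?R" if "T \<subseteq> carrier H" for T
    using that by (auto intro!: in_R simp: H.dilate_def indicator_def)
  have mult: "indicator T \<otimes>\<^bsub>?R\<^esub> indicator T' = H.conv (indicator T) (indicator T')"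
    if "T \<subseteq> carrier H" "T' \<subseteq> carrier H" for T T'
    using that H.finite_carrier by (intro H.group_ring_mult_conv) (auto simp: indicator_def)
  have pow2: "f [^]\<^bsub>?R\<^esub> (2::nat) = f \<otimes>\<^bsub>?R\<^esub> f" if "f \<in> carrier ?R" for f
    using that by (simp add: numeral_2_eq_2)
  interpret lee_pair H n T\<^sub>0 T\<^sub>1
  proof
    show "H.conv (indicator T\<^sub>0) (indicator T\<^sub>1) = ?J - ?e"
      using prod T by (simp add: mult minus one ind)
    show "H.conv (indicator T\<^sub>0) (indicator T\<^sub>0) + H.conv (indicator T\<^sub>1) (indicator T\<^sub>1) =
        2 * ?J - (H.dilate (indicator T\<^sub>0) + H.dilate (indicator T\<^sub>1)) + of_int (2 * int n) * ?e"
    proof -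
      \<comment> \<open>Ring subtraction is pointwise by \<open>minus\<close> only for members of
        the carrier, so the intermediate terms of the right side need membership.\<close>
      have "2 * ?J \<in> carrier ?R" "2 * ?J - H.dilate (indicator T\<^sub>0) \<in> carrier ?R"
        by (auto intro!: in_R simp: H.dilate_def)
      then show ?thesis
        using squares T
        by (simp add: pow2 ind mult minus plus one group_ring_add_pow H.power_map_2_indicator diff_diff_eq)
    qed
  qed (use T assms in \<open>auto intro: H.symmetric_fun_indicator\<close>)
  show False
  proof (rule no_pair)
    \<comment> \<open>Being odd, 2 modulo 3 and 0 modulo 5 means n = 5 modulo 30, so from 19 on the
      first candidate is 35. The estimate n^2 <= 24 n + 11 is refuted from 25 on.\<close>
    have "n \<ge> 25" if "n \<ge> 19" "[n = 0] (mod 5)"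
      using that \<open>odd n\<close> \<open>[n = 2] (mod 3)\<close> unfolding cong_def by presburger
    then show "(n \<ge> 25 \<and> [int n = 0] (mod 5)) \<or>
         (n \<ge> 207 \<and> [int n = 1] (mod 5)) \<or>
         (n \<ge> 114 \<and> [int n = 2] (mod 5)) \<or>
         (n \<ge> 154 \<and> [int n = 3] (mod 5)) \<or>
         (n \<ge> 232 \<and> [int n = 4] (mod 5))"
      using assms(4) cong_int_iff[of n _ 5] by (metis of_nat_0 of_nat_1 of_nat_numeral)
    show "[int n = 2] (mod 3)"
      using assms(3) cong_int_iff[of n 2 3] by simp
  qed
qed

end
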